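(* Let $0<p<1$ and let $\mathcal{M}=\{M_n\}_{n\ge0}$ be an increasing, logarithmically convex weight sequence such that $\kappa(p,\mathcal{M})<+\infty$. Let $0\le\theta<\theta'$. Then the inclusion $W_{\mathcal{M}}^{p,\theta}\subset W_{\mathcal{M}}^{p,\theta'}$ is strict: $W_{\mathcal{M}}^{p,\theta}\ne W_{\mathcal{M}}^{p,\theta'}$.
   Context: $\|f\|_p=(\int_{\mathbb{R}}|f|^p\,dx)^{1/p}$ is the quasinorm of $L^p=L^p(\mathbb{R})$. A weight sequence $\mathcal{M}=\{M_n\}_{n\ge 0}$ is a sequence of positive real numbers; it is logarithmically convex if $n\mapsto\log M_n$ is convex. The $p$-characteristic is $\kappa(p,\mathcal{M})=\limsup_{n\to+\infty}\sum_{j=1}^{n}(1-p)^j\log M_j$. For $f\in C^\infty(\mathbb{R})$ put $\|f\|_{p,\mathcal{M}}=\sup_{n\ge 0}\|f^{(n)}\|_p/M_n$. For $\theta\ge0$ the test class is \[ \mathscr{S}_{p,\theta,\mathcal{M}}^\circledast=\Big\{f\in C^\infty(\mathbb{R}):\ \|f\|_{p,\mathcal{M}}<+\infty\ \text{ and }\ \limsup_{n\to+\infty}(1-p)^n\log\|f^{(n)}\|_\infty\le\theta\Big\} \] (with $\log 0=-\infty$). The $L^p$-Carleman space $W^{p,\theta}_{\mathcal{M}}$ is the abstract completion of $\mathscr{S}_{p,\theta,\mathcal{M}}^\circledast$ with respect to $\|\cdot\|_{p,\mathcal{M}}$. The inclusion $W_{\mathcal{M}}^{p,\theta}\subset W_{\mathcal{M}}^{p,\theta'}$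 is the isometric one induced by $\mathscr{S}_{p,\theta,\mathcal{M}}^\circledast\subset\mathscr{S}_{p,\theta',\mathcal{M}}^\circledast$. *)

theory Defs
  imports "HOL-Analysis.Analysis"
begin

text \<open>Functions on the line are complex-valued, with derivatives taken in the real variable.\<close>

definition nderiv :: "nat \<Rightarrow> (real \<Rightarrow> complex) \<Rightarrow> real \<Rightarrow> complex"
  where "nderiv n f = ((\<lambda>g x. vector_derivative g (at x)) ^^ n) f"

definition smooth :: "(real \<Rightarrow> complex) \<Rightarrow> bool"
  where "smooth f \<longleftrightarrow> (\<forall>n x. nderiv n f differentiable (at x))"

text \<open>Power with exponent \<open>a > 0\<close> and logarithm on \<open>[0, \<infinity>]\<close>, with \<open>\<infinity>\<^sup>a = \<infinity>\<close>,
  \<open>log 0 = -\<infinity>\<close> and \<open>log \<infinity> = \<infinity>\<close>.\<close>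

definition epowr :: "ennreal \<Rightarrow> real \<Rightarrow> ennreal"
  where "epowr x a = (if x = top then top else ennreal (enn2real x powr a))"

definition eln :: "ennreal \<Rightarrow> ereal"
  where "eln x = (if x = 0 then -\<infinity> else if x = top then \<infinity> else ereal (ln (enn2real x)))"

definition Lp_qnorm :: "real \<Rightarrow> (real \<Rightarrow> complex) \<Rightarrow> ennreal"
  where "Lp_qnorm p f = epowr (\<integral>\<^sup>+x. ennreal (norm (f x) powr p) \<partial>lborel) (1 / p)"

text \<open>The plain supremum; it is only applied to continuous functions, where it agrees with the
  essential supremum.\<close>

definition sup_norm :: "(real \<Rightarrow> complex) \<Rightarrow> ennreal"
  where "sup_norm f = (SUP x. ennreal (norm (f x)))"

definition weight_sequence :: "(nat \<Rightarrow> real) \<Rightarrow> bool"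
  where "weight_sequence M \<longleftrightarrow> (\<forall>n. M n > 0)"

definition log_convex_seq :: "(nat \<Rightarrow> real) \<Rightarrow> bool"
  where "log_convex_seq M \<longleftrightarrow> (\<forall>n. 2 * ln (M (n + 1)) \<le> ln (M n) + ln (M (n + 2)))"

definition p_characteristic :: "real \<Rightarrow> (nat \<Rightarrow> real) \<Rightarrow> ereal"
  where "p_characteristic p M = limsup (\<lambda>n. ereal (\<Sum>j=1..n. (1 - p) ^ j * ln (M j)))"

definition carleman_qnorm :: "real \<Rightarrow> (nat \<Rightarrow> real) \<Rightarrow> (real \<Rightarrow> complex) \<Rightarrow> ennreal"
  where "carleman_qnorm p M f = (SUP n. Lp_qnorm p (nderiv n f) / ennreal (M n))"

definition test_class :: "real \<Rightarrow> real \<Rightarrow> (nat \<Rightarrow> real) \<Rightarrow> (real \<Rightarrow> complex) set"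
  where "test_class p \<theta> M = {f. smooth f \<and> carleman_qnorm p M f < top \<and>
    limsup (\<lambda>n. ereal ((1 - p) ^ n) * eln (sup_norm (nderiv n f))) \<le> ereal \<theta>}"

text \<open>The completion is realised as the set of Cauchy sequences in the test class modulo the
  sequences whose difference is null.\<close>

definition test_Cauchy :: "real \<Rightarrow> real \<Rightarrow> (nat \<Rightarrow> real) \<Rightarrow> (nat \<Rightarrow> real \<Rightarrow> complex) set"
  where "test_Cauchy p \<theta> M = {u. range u \<subseteq> test_class p \<theta> M \<and>
    (\<forall>\<epsilon>>0. \<exists>N. \<forall>m\<ge>N. \<forall>n\<ge>N. carleman_qnorm p M (\<lambda>x. u m x - u n x) < ennreal \<epsilon>)}"

definition null_rel :: "real \<Rightarrow> real \<Rightarrow> (nat \<Rightarrow> real) \<Rightarrow> (nat \<Rightarrow> real \<Rightarrow> complex) rel"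
  where "null_rel p \<theta> M = {(u, v). u \<in> test_Cauchy p \<theta> M \<and> v \<in> test_Cauchy p \<theta> M \<and>
    (\<lambda>n. carleman_qnorm p M (\<lambda>x. u n x - v n x)) \<longlonglongrightarrow> 0}"

definition carleman_space ::
    "real \<Rightarrow> real \<Rightarrow> (nat \<Rightarrow> real) \<Rightarrow> (nat \<Rightarrow> real \<Rightarrow> complex) set set"
  where "carleman_space p \<theta> M = test_Cauchy p \<theta> M // null_rel p \<theta> M"

text \<open>The canonical map into the completion with parameter \<open>\<theta>'\<close>: the class of \<open>u\<close> at level
  \<open>\<theta>\<close> goes to the class of \<open>u\<close> at level \<open>\<theta>'\<close> (lemma \<open>carleman_incl_class\<close>).\<close>

definition carleman_incl ::
    "real \<Rightarrow> real \<Rightarrow> (nat \<Rightarrow> real) \<Rightarrow> (nat \<Rightarrow> real \<Rightarrow> complex) set \<Rightarrow> (nat \<Rightarrow> real \<Rightarrow> complex) set"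
  where "carleman_incl p \<theta>' M C = null_rel p \<theta>' M `` C"


lemma nderiv_Suc: "nderiv (Suc n) f x = vector_derivative (nderiv n f) (at x)"
  by (simp add: nderiv_def)

lemma nderiv_diff:
  assumes "smooth f" "smooth g"
  shows "nderiv n (\<lambda>x. f x - g x) = (\<lambda>x. nderiv n f x - nderiv n g x)"
proof (induction n)
  case 0
  show ?case by (simp add: nderiv_def)
next
  case (Suc n)
  show ?case
  proof
    fix x
    have "nderiv n f differentiable (at x)" "nderiv n g differentiable (at x)"
      using assms by (auto simp: smooth_def)
    then show "nderiv (Suc n) (\<lambda>x. f x - g x) x = nderiv (Suc n) f x - nderiv (Suc n) g x"
      by (simp add: nderiv_Suc Suc.IH)
  qed
qed

lemma smooth_diff: "smooth f \<Longrightarrow> smooth g \<Longrightarrow> smooth (\<lambda>x. f x - g x)"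
  using nderiv_diff[of f g] by (auto simp: smooth_def intro!: differentiable_diff)

lemma smooth_nderiv_measurable: "smooth f \<Longrightarrow> nderiv n f \<in> borel_measurable borel"
  by (intro borel_measurable_continuous_onI continuous_at_imp_continuous_on)
     (auto simp: smooth_def intro: differentiable_imp_continuous_within)

lemma epowr_mono: "x \<le> y \<Longrightarrow> 0 \<le> a \<Longrightarrow> epowr x a \<le> epowr y a"
  unfolding epowr_def
  by (auto simp: top_unique less_top intro!: ennreal_leI powr_mono2 enn2real_mono)

lemma epowr_double: "epowr (2 * x) a = ennreal (2 powr a) * epowr x a"
proof (cases x)
  case (real r)
  then have *: "2 * x = ennreal (2 * r)" by (simp add: ennreal_mult)
  have "epowr (2 * x) a = ennreal ((2 * r) powr a)"
    unfolding * epowr_def using real(1) by (simp only: ennreal_neq_top if_False enn2real_ennreal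
        mult_nonneg_nonneg zero_le_numeral)
  also have "\<dots> = ennreal (2 powr a) * ennreal (r powr a)"
    using real(1) by (simp add: powr_mult ennreal_mult)
  finally show ?thesis using real by (simp add: epowr_def)
next
  case top
  then show ?thesis by (simp add: epowr_def ennreal_mult_top ennreal_top_mult ennreal_mult_eq_top_iff)
qed

lemma Lp_qnorm_diff:
  assumes p: "0 < p" "p \<le> 1" and [measurable]: "f \<in> borel_measurable borel" "g \<in> borel_measurable borel"
  shows "Lp_qnorm p (\<lambda>x. f x - g x) \<le> ennreal (2 powr (1 / p)) * max (Lp_qnorm p f) (Lp_qnorm p g)"
proof -
  let ?I = "\<lambda>f. \<integral>\<^sup>+x. ennreal (norm (f x :: complex) powr p) \<partial>lborel"
  have pt: "norm (f x - g x) powr p \<le> norm (f x) powr p + norm (g x) powr p" for x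
  proof -
    define a b s where "a = norm (f x)" "b = norm (g x)" "s = a + b"
    note d = this
    have ab: "a \<ge> 0" "b \<ge> 0" using d by auto
    have "norm (f x - g x) powr p \<le> s powr p"
      using p by (auto simp: d intro!: powr_mono2 norm_triangle_ineq4)
    also have "s powr p \<le> a powr p + b powr p"
    proof (cases "s = 0")
      case False
      then have s: "s > 0" using ab d by linarith
      have "t \<le> t powr p" if "0 \<le> t" "t \<le> 1" for t :: real
        using powr_mono'[of p 1 t] that p by simp
      from this[of "a / s"] this[of "b / s"]
      have "a / s + b / s \<le> (a / s) powr p + (b / s) powr p"
        using ab s d by (auto intro!: add_mono)
      moreover have "a / s + b / s = 1" using s d(3) by (simp flip: add_divide_distrib)
      ultimately have "1 \<le> (a powr p + b powr p) / s powr p"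
        using ab s by (simp add: powr_divide add_divide_distrib)
      then show ?thesis using s by (simp add: field_simps)
    qed auto
    finally show ?thesis by (simp add: d)
  qed
  have "?I (\<lambda>x. f x - g x) \<le> (\<integral>\<^sup>+x. ennreal (norm (f x) powr p) + ennreal (norm (g x) powr p) \<partial>lborel)"
    using pt by (intro nn_integral_mono) (simp flip: ennreal_plus)
  also have "\<dots> = ?I f + ?I g"
    by (rule nn_integral_add) auto
  also have "\<dots> \<le> 2 * max (?I f) (?I g)"
    by (simp add: mult_2 add_mono)
  finally have "Lp_qnorm p (\<lambda>x. f x - g x) \<le> epowr (2 * max (?I f) (?I g)) (1 / p)"
    unfolding Lp_qnorm_def using p by (intro epowr_mono) auto
  also have "\<dots> = ennreal (2 powr (1 / p)) * epowr (max (?I f) (?I g)) (1 / p)"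
    by (rule epowr_double)
  also have "epowr (max (?I f) (?I g)) (1 / p) \<le> max (Lp_qnorm p f) (Lp_qnorm p g)"
    unfolding Lp_qnorm_def max_def by auto
  finally show ?thesis by (simp add: mult_left_mono)
qed

lemma carleman_qnorm_diff:
  assumes p: "0 < p" "p \<le> 1" and fg: "smooth f" "smooth g"
  shows "carleman_qnorm p M (\<lambda>x. f x - g x)
    \<le> ennreal (2 powr (1 / p)) * max (carleman_qnorm p M f) (carleman_qnorm p M g)"
  unfolding carleman_qnorm_def
proof (rule SUP_least)
  fix n
  let ?q = "\<lambda>f n. Lp_qnorm p (nderiv n f) / ennreal (M n)"
  have "?q (\<lambda>x. f x - g x) n \<le> ennreal (2 powr (1 / p)) *
      max (Lp_qnorm p (nderiv n f)) (Lp_qnorm p (nderiv n g)) / ennreal (M n)"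
    using Lp_qnorm_diff[OF p smooth_nderiv_measurable[OF fg(1)] smooth_nderiv_measurable[OF fg(2)]]
    by (simp add: nderiv_diff[OF fg] divide_right_mono_ennreal)
  also have "\<dots> = ennreal (2 powr (1 / p)) *
      (max (Lp_qnorm p (nderiv n f)) (Lp_qnorm p (nderiv n g)) / ennreal (M n))"
    by (simp add: ennreal_times_divide)
  also have "\<dots> \<le> ennreal (2 powr (1 / p)) * max (?q f n) (?q g n)"
    by (intro mult_left_mono) (auto simp: max_def)
  also have "\<dots> \<le> ennreal (2 powr (1 / p)) * max (SUP n. ?q f n) (SUP n. ?q g n)"
    by (intro mult_left_mono max.mono SUP_upper) auto
  finally show "?q (\<lambda>x. f x - g x) n \<le> \<dots>" .
qed

lemma norm_nderiv_commute:
  assumes "smooth f" "smooth g"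
  shows "norm (nderiv n (\<lambda>x. f x - g x) t) = norm (nderiv n (\<lambda>x. g x - f x) t)"
  using assms by (simp add: nderiv_diff norm_minus_commute)

lemma carleman_qnorm_commute:
  assumes "smooth f" "smooth g"
  shows "carleman_qnorm p M (\<lambda>x. f x - g x) = carleman_qnorm p M (\<lambda>x. g x - f x)"
  by (simp add: carleman_qnorm_def Lp_qnorm_def norm_nderiv_commute[OF assms])

lemma carleman_qnorm_zero: "carleman_qnorm p M (\<lambda>x. 0) = 0"
proof -
  have "nderiv n (\<lambda>x. 0) = (\<lambda>x. 0)" for n
    by (induction n) (auto simp: nderiv_def)
  then show ?thesis
    by (simp add: carleman_qnorm_def Lp_qnorm_def epowr_def)
qed

lemma test_Cauchy_smooth: "u \<in> test_Cauchy p \<theta> M \<Longrightarrow> smooth (u n)"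
  by (auto simp: test_Cauchy_def test_class_def)

lemma equiv_null_rel:
  assumes p: "0 < p" "p \<le> 1"
  shows "equiv (test_Cauchy p \<theta> M) (null_rel p \<theta> M)"
proof (rule equivI)
  show "null_rel p \<theta> M \<subseteq> test_Cauchy p \<theta> M \<times> test_Cauchy p \<theta> M"
    by (auto simp: null_rel_def)
  show "refl_on (test_Cauchy p \<theta> M) (null_rel p \<theta> M)"
    by (auto simp: refl_on_def null_rel_def carleman_qnorm_zero)
  show "sym (null_rel p \<theta> M)"
    by (auto simp: sym_def null_rel_def carleman_qnorm_commute[OF test_Cauchy_smooth test_Cauchy_smooth])
  show "trans (null_rel p \<theta> M)"
  proof (rule transI)
    fix u v w
    assume uv: "(u, v) \<in> null_rel p \<theta> M" and vw: "(v, w) \<in> null_rel p \<theta> M"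
    let ?q = "\<lambda>u v n. carleman_qnorm p M (\<lambda>x. u n x - v n x)"
    have C: "u \<in> test_Cauchy p \<theta> M" "v \<in> test_Cauchy p \<theta> M" "w \<in> test_Cauchy p \<theta> M"
      and l1: "?q u v \<longlonglongrightarrow> 0" and l2: "?q v w \<longlonglongrightarrow> 0"
      using uv vw by (auto simp: null_rel_def)
    note s = C[THEN test_Cauchy_smooth]
    have "?q w v \<longlonglongrightarrow> 0"
      using l2 by (simp add: carleman_qnorm_commute[OF s(3) s(2)])
    then have "(\<lambda>n. ennreal (2 powr (1 / p)) * max (?q u v n) (?q w v n)) \<longlonglongrightarrow>
        ennreal (2 powr (1 / p)) * max 0 0"
      by (intro ennreal_tendsto_cmult tendsto_max l1) auto
    then have lim: "(\<lambda>n. ennreal (2 powr (1 / p)) * max (?q u v n) (?q w v n)) \<longlonglongrightarrow> 0"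
      by simp
    have le: "?q u w n \<le> ennreal (2 powr (1 / p)) * max (?q u v n) (?q w v n)" for n
      using carleman_qnorm_diff[OF p smooth_diff[OF s(1) s(2), of n n] smooth_diff[OF s(3) s(2), of n n]]
      by simp
    have "?q u w \<longlonglongrightarrow> 0"
      by (rule tendsto_sandwich[OF _ _ tendsto_const lim]) (use le in auto)
    then show "(u, w) \<in> null_rel p \<theta> M" using C by (auto simp: null_rel_def)
  qed
qed

lemma test_class_mono: "\<theta> \<le> \<theta>' \<Longrightarrow> test_class p \<theta> M \<subseteq> test_class p \<theta>' M"
  by (auto simp: test_class_def intro: order_trans)

lemma test_Cauchy_mono: "\<theta> \<le> \<theta>' \<Longrightarrow> test_Cauchy p \<theta> M \<subseteq> test_Cauchy p \<theta>' M"
  using test_class_mono[of \<theta> \<theta>' p M] by (auto simp: test_Cauchy_def)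

lemma null_rel_restrict:
  "\<theta> \<le> \<theta>' \<Longrightarrow> null_rel p \<theta> M =
    null_rel p \<theta>' M \<inter> test_Cauchy p \<theta> M \<times> test_Cauchy p \<theta> M"
  using test_Cauchy_mono[of \<theta> \<theta>' p M] by (auto simp: null_rel_def)

lemma carleman_incl_class:
  assumes p: "0 < p" "p \<le> 1" and "\<theta> \<le> \<theta>'" and u: "u \<in> test_Cauchy p \<theta> M"
  shows "carleman_incl p \<theta>' M (null_rel p \<theta> M `` {u}) = null_rel p \<theta>' M `` {u}"
    (is "?L = ?R")
proof
  have E: "equiv (test_Cauchy p \<theta>' M) (null_rel p \<theta>' M)" by (rule equiv_null_rel[OF p])
  show "?L \<subseteq> ?R"
    using E null_rel_restrict[OF assms(3), of p M]
    unfolding equiv_def trans_def carleman_incl_def by blast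
  have "(u, u) \<in> null_rel p \<theta> M"
    using equiv_null_rel[OF p, of \<theta> M] u by (auto simp: equiv_def refl_on_def)
  then show "?R \<subseteq> ?L" by (auto simp: carleman_incl_def)
qed

lemma carleman_incl_space:
  assumes p: "0 < p" "p \<le> 1" and le: "\<theta> \<le> \<theta>'"
  shows "carleman_incl p \<theta>' M ` carleman_space p \<theta> M \<subseteq> carleman_space p \<theta>' M"
  using carleman_incl_class[OF p le] test_Cauchy_mono[OF le, of p M]
  by (auto simp: carleman_space_def elim!: quotientE intro!: quotientI)

lemma inj_on_carleman_incl:
  assumes p: "0 < p" "p \<le> 1" and le: "\<theta> \<le> \<theta>'"
  shows "inj_on (carleman_incl p \<theta>' M) (carleman_space p \<theta> M)"
proof (rule inj_onI)
  fix C D assume "C \<in> carleman_space p \<theta> M" "D \<in> carleman_space p \<theta> M"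
    and eq: "carleman_incl p \<theta>' M C = carleman_incl p \<theta>' M D"
  then obtain u v where uv: "u \<in> test_Cauchy p \<theta> M" "v \<in> test_Cauchy p \<theta> M"
    and CD: "C = null_rel p \<theta> M `` {u}" "D = null_rel p \<theta> M `` {v}"
    by (auto simp: carleman_space_def elim!: quotientE)
  have "null_rel p \<theta>' M `` {u} = null_rel p \<theta>' M `` {v}"
    using eq carleman_incl_class[OF p le] uv CD by simp
  then have "(u, v) \<in> null_rel p \<theta>' M"
    using eq_equiv_class[OF _ equiv_null_rel[OF p]] test_Cauchy_mono[OF le] uv by blast
  then have "(u, v) \<in> null_rel p \<theta> M"
    using uv null_rel_restrict[OF le] by blast
  then show "C = D"
    using equiv_class_eq[OF equiv_null_rel[OF p]] CD by blast
qed

end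

theory Submission
  imports Defs
begin

text \<open>
  Write \<open>q = 1 - p\<close>. Since \<open>norm f' \<le> norm f' powr p * sup_norm f' powr q\<close>, integration gives
  \<open>sup_norm f \<le> Lp_qnorm p f' powr p * sup_norm f' powr q\<close>. Iterating this shows that for
  \<open>f\<close> in the test class with parameter \<open>\<theta>\<close> and quasinorm at most \<open>A\<close>,
  \<open>q ^ k * ln (sup_norm (nderiv k f)) \<le> q ^ k * ln A + \<theta> + (p / q) * (S - s k)\<close>, where
  \<open>s k\<close> are the partial sums of the characteristic and \<open>S\<close> their limit. Hence convergence in the
  quasinorm forces uniform convergence of all derivatives, the bound passes to limits, and a
  function of the larger test class that is approximated from the smaller one already belongs to it.

  It remains to find a function in the larger test class whose \<open>limsup\<close> is exactly \<open>\<theta>'\<close>. It is an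
  infinite convolution of the normalised indicators of \<open>[0, a n]\<close> with doubly exponentially
  decreasing \<open>a n\<close>: its \<open>n\<close>-th derivative consists of \<open>2 ^ n\<close> very tall and very narrow pieces,
  which keeps the \<open>L\<^sup>p\<close> quasinorms bounded while the suprema grow like \<open>exp (\<theta>' / q ^ n)\<close>.
\<close>

section \<open>A priori bounds on derivatives from the quasinorm\<close>

text \<open>The integral of \<open>norm g'\<close> bounds every difference \<open>g v - g u\<close>.
  To bound \<open>g\<close> itself an almost-zero is needed: if \<open>norm g\<close> stayed above
  some \<open>\<delta> > 0\<close>, its \<open>p\<close>-th power would have infinite integral over
  the line.\<close>

lemma sup_bound_by_derivative:
  fixes g g' :: "real \<Rightarrow> complex"
  assumes p: "0 < p" "p < 1"
    and deriv: "\<And>x. (g has_vector_derivative g' x) (at x)" and cont: "continuous_on UNIV g'"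
    and fin: "(\<integral>\<^sup>+x. ennreal (norm (g x) powr p) \<partial>lborel) < \<infinity>"
    and I: "(\<integral>\<^sup>+x. ennreal (norm (g' x) powr p) \<partial>lborel) \<le> ennreal I" "0 \<le> I"
    and B: "\<And>x. norm (g' x) \<le> B"
  shows "norm (g x) \<le> I * B powr (1 - p)"
proof -
  define K where "K = I * B powr (1 - p)"
  have [measurable]: "g' \<in> borel_measurable borel"
    using cont by (rule borel_measurable_continuous_onI)
  have "continuous_on UNIV g"
    using deriv by (intro continuous_at_imp_continuous_on ballI has_vector_derivative_continuous)
  then have [measurable]: "g \<in> borel_measurable borel"
    by (rule borel_measurable_continuous_onI)
  have "0 \<le> K" using I by (simp add: K_def)
  have pt: "norm (g' x) \<le> norm (g' x) powr p * B powr (1 - p)" for x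
  proof (cases "g' x = 0")
    case False
    then have "norm (g' x) = norm (g' x) powr p * norm (g' x) powr (1 - p)"
      by (simp flip: powr_add)
    also have "\<dots> \<le> norm (g' x) powr p * B powr (1 - p)"
      using B p by (intro mult_left_mono powr_mono2) auto
    finally show ?thesis .
  qed auto
  have osc: "norm (g v - g u) \<le> K" if "u \<le> v" for u v
  proof -
    have cg: "continuous_on {u..v} (\<lambda>x. norm (g' x))"
      using continuous_on_subset[OF cont] by (intro continuous_intros) auto
    have int: "(g' has_integral (g v - g u)) {u..v}"
      using that deriv by (intro fundamental_theorem_of_calculus)
        (auto intro: has_vector_derivative_at_within)
    have hn: "((\<lambda>x. norm (g' x)) has_integral integral {u..v} (\<lambda>x. norm (g' x))) {u..v}"
      by (intro integrable_integral integrable_continuous_interval cg)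
    have "ennreal (integral {u..v} (\<lambda>x. norm (g' x)))
        = (\<integral>\<^sup>+x. ennreal (norm (g' x)) * indicator {u..v} x \<partial>lborel)"
      using nn_integral_has_integral_lebesgue'[OF _ hn] by simp
    also have "\<dots> \<le> (\<integral>\<^sup>+x. ennreal (B powr (1 - p)) * ennreal (norm (g' x) powr p) \<partial>lborel)"
      using pt by (intro nn_integral_mono)
        (auto simp: indicator_def mult.commute simp flip: ennreal_mult intro!: ennreal_leI)
    also have "\<dots> = ennreal (B powr (1 - p)) * (\<integral>\<^sup>+x. ennreal (norm (g' x) powr p) \<partial>lborel)"
      by (intro nn_integral_cmult) auto
    also have "\<dots> \<le> ennreal (B powr (1 - p)) * ennreal I"
      using I by (intro mult_left_mono) auto
    also have "\<dots> = ennreal K"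
      using I by (simp add: K_def mult.commute flip: ennreal_mult)
    finally have "integral {u..v} (\<lambda>x. norm (g' x)) \<le> K"
      using \<open>0 \<le> K\<close> by simp
    moreover have "norm (integral {u..v} g') \<le> integral {u..v} (\<lambda>x. norm (g' x))"
      using int hn by (intro integral_norm_bound_integral) (auto simp: has_integral_integrable)
    ultimately show ?thesis
      using int by (simp add: integral_unique)
  qed
  have small: "\<exists>y. norm (g y) < \<delta>" if "\<delta> > 0" for \<delta>
  proof (rule ccontr)
    assume "\<nexists>y. norm (g y) < \<delta>"
    then have low: "\<delta> powr p \<le> norm (g y) powr p" for y
      using that p by (intro powr_mono2) (auto simp: not_less)
    have "(\<integral>\<^sup>+x. ennreal (\<delta> powr p) \<partial>(lborel :: real measure)) \<le> (\<integral>\<^sup>+x. ennreal (norm (g x) powr p) \<partial>lborel)"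
      by (intro nn_integral_mono ennreal_leI low)
    moreover have "(\<integral>\<^sup>+x. ennreal (\<delta> powr p) \<partial>(lborel :: real measure)) = \<infinity>"
      using that by (simp add: ennreal_mult_top)
    ultimately show False using fin by (simp add: top_unique)
  qed
  have "norm (g x) \<le> K"
  proof (rule field_le_epsilon)
    fix \<delta> :: real assume "\<delta> > 0"
    from small[OF this] obtain y where y: "norm (g y) < \<delta>" by blast
    have "norm (g x - g y) \<le> K"
      using osc[of x y] osc[of y x] by (cases "x \<le> y") (auto simp: norm_minus_commute)
    then show "norm (g x) \<le> K + \<delta>"
      using y norm_triangle_ineq2[of "g x" "g y"] by linarith
  qed
  then show ?thesis by (simp add: K_def)
qed

lemma nderiv_has_vector_derivative:
  "smooth f \<Longrightarrow> (nderiv n f has_vector_derivative nderiv (Suc n) f x) (at x)"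
  by (simp add: smooth_def nderiv_Suc flip: vector_derivative_works)

text \<open>Clearing the root \<open>1 / p\<close> and the weight gives the integral bounds in the
  form that \<open>sup_bound_by_derivative\<close> consumes.\<close>

lemma carleman_qnorm_le_iff:
  assumes "0 < p" "0 \<le> A" and M: "\<And>n. 0 < M n"
  shows "carleman_qnorm p M f \<le> ennreal A \<longleftrightarrow>
    (\<forall>n. (\<integral>\<^sup>+x. ennreal (norm (nderiv n f x) powr p) \<partial>lborel) \<le> ennreal ((A * M n) powr p))"
proof -
  have *: "epowr I (1 / p) / ennreal m \<le> ennreal A \<longleftrightarrow> I \<le> ennreal ((A * m) powr p)"
    if "0 < m" for I and m :: real
  proof (cases I)
    case (real r)
    have "epowr I (1 / p) / ennreal m = ennreal (r powr (1 / p) / m)"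
      using real that by (simp add: epowr_def divide_ennreal)
    also have "\<dots> \<le> ennreal A \<longleftrightarrow> r powr (1 / p) \<le> A * m"
      using assms that by (simp add: field_simps)
    also have "\<dots> \<longleftrightarrow> r \<le> (A * m) powr p"
    proof
      assume "r powr (1 / p) \<le> A * m"
      then have "(r powr (1 / p)) powr p \<le> (A * m) powr p"
        using assms by (intro powr_mono2) auto
      then show "r \<le> (A * m) powr p" using real assms by (simp add: powr_powr)
    next
      assume "r \<le> (A * m) powr p"
      then have "r powr (1 / p) \<le> ((A * m) powr p) powr (1 / p)"
        using assms real by (intro powr_mono2) auto
      then show "r powr (1 / p) \<le> A * m" using real assms that by (simp add: powr_powr)
    qed
    finally show ?thesis using real by simp
  next
    case top
    then show ?thesis by (simp add: epowr_def ennreal_top_divide top_unique)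
  qed
  show ?thesis
    by (simp add: carleman_qnorm_def Lp_qnorm_def SUP_le_iff * M)
qed

text \<open>The one-step bound is iterated from level \<open>k + m\<close> down to \<open>k\<close>,
  then \<open>m\<close> tends to infinity. Each step multiplies the exponent by
  \<open>1 - p\<close>, so the start value \<open>T / (1 - p) ^ (k + m)\<close> arrives as
  \<open>T / (1 - p) ^ k\<close> for every \<open>m\<close>. The result is linear in
  \<open>A\<close>: for fixed \<open>T\<close>, small quasinorm forces every derivative to be
  uniformly small.\<close>

lemma nderiv_bound:
  fixes f :: "real \<Rightarrow> complex"
  assumes p: "0 < p" "p < 1" and M: "\<And>n. 0 < M n"
    and conv: "(\<lambda>n. \<Sum>j=1..n. (1 - p) ^ j * ln (M j)) \<longlonglongrightarrow> S"
    and f: "smooth f" and A: "0 < A" "carleman_qnorm p M f \<le> ennreal A"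
    and grow: "\<forall>\<^sub>F n in sequentially. \<forall>x. norm (nderiv n f x) \<le> exp (T / (1 - p) ^ n)"
  shows "norm (nderiv k f x) \<le>
    A * exp ((T + p / (1 - p) * (S - (\<Sum>j=1..k. (1 - p) ^ j * ln (M j)))) / (1 - p) ^ k)"
proof -
  define q where "q = 1 - p"
  have q: "0 < q" "q < 1" using p by (auto simp: q_def)
  define s where "s n = (\<Sum>j=1..n. q ^ j * ln (M j))" for n
  have Lp: "(\<integral>\<^sup>+x. ennreal (norm (nderiv n f x) powr p) \<partial>lborel) \<le> ennreal ((A * M n) powr p)" for n
    using A(2) carleman_qnorm_le_iff[of p A M f] p A(1) M by auto
  \<comment> \<open>Solves the recursion
    \<open>L k (Suc m) = p * (ln A + ln (M (Suc k))) + q * L (Suc k) m\<close> with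
    \<open>L k 0 = T / q ^ k\<close>.\<close>
  define L where "L k m = (1 - q ^ m) * ln A + (T + p / q * (s (k + m) - s k)) / q ^ k" for k m
  have bound: "norm (nderiv k f x) \<le> exp (L k m)"
    if "\<And>x. norm (nderiv (k + m) f x) \<le> exp (T / q ^ (k + m))" for k m x
    using that
  proof (induction m arbitrary: k x)
    case 0
    then show ?case by (simp add: L_def)
  next
    case (Suc m)
    have B: "norm (nderiv (Suc k) f x) \<le> exp (L (Suc k) m)" for x
      using Suc.IH[of "Suc k"] Suc.prems by simp
    have "norm (nderiv k f x) \<le> (A * M (Suc k)) powr p * exp (L (Suc k) m) powr (1 - p)"
    proof (rule sup_bound_by_derivative[OF p nderiv_has_vector_derivative[OF f] _ _ Lp _ B])
      show "continuous_on UNIV (nderiv (Suc k) f)"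
        using f by (intro continuous_at_imp_continuous_on)
          (auto simp: smooth_def intro: differentiable_imp_continuous_within)
      show "(\<integral>\<^sup>+x. ennreal (norm (nderiv k f x) powr p) \<partial>lborel) < \<infinity>"
        using Lp[of k] by (rule le_less_trans) simp
    qed auto
    also have "\<dots> = exp (p * (ln A + ln (M (Suc k))) + q * L (Suc k) m)"
      using A(1) M[of "Suc k"] by (simp add: powr_def ln_mult exp_add q_def)
    also have "p * (ln A + ln (M (Suc k))) + q * L (Suc k) m = L k (Suc m)"
    proof -
      have "s (Suc k) = s k + q ^ Suc k * ln (M (Suc k))" by (simp add: s_def)
      moreover have p_eq: "p = 1 - q" by (simp add: q_def)
      ultimately show ?thesis using q unfolding L_def p_eq by (simp add: field_simps)
    qed
    finally show ?case .
  qed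
  obtain n0 where n0: "\<And>n x. n \<ge> n0 \<Longrightarrow> norm (nderiv n f x) \<le> exp (T / q ^ n)"
    using grow by (auto simp: eventually_sequentially q_def)
  have "s \<longlonglongrightarrow> S" using conv by (simp add: s_def[abs_def] q_def)
  then have "(\<lambda>m. s (m + k)) \<longlonglongrightarrow> S" by (rule LIMSEQ_ignore_initial_segment)
  then have sk: "(\<lambda>m. s (k + m)) \<longlonglongrightarrow> S" by (simp add: add.commute)
  have "(\<lambda>m. exp (L k m)) \<longlonglongrightarrow> exp ((1 - 0) * ln A + (T + p / q * (S - s k)) / q ^ k)"
    unfolding L_def using q by (intro tendsto_intros sk LIMSEQ_power_zero) auto
  moreover have "\<forall>\<^sub>F m in sequentially. norm (nderiv k f x) \<le> exp (L k m)"
    using eventually_ge_at_top[of n0] by eventually_elim (use n0 in \<open>auto intro!: bound\<close>)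
  ultimately have "norm (nderiv k f x) \<le> exp ((1 - 0) * ln A + (T + p / q * (S - s k)) / q ^ k)"
    by (intro tendsto_lowerbound) auto
  then show ?thesis using A(1) by (simp add: exp_add s_def q_def)
qed

section \<open>The infinite convolution of uniform densities\<close>

lemma integrable_affine_window:
  fixes g :: "real \<Rightarrow> real"
  assumes "continuous_on UNIV g"
  shows "(\<lambda>t. g (z - c * t)) integrable_on {0..1}"
proof (rule integrable_continuous_interval)
  have "continuous_on {0..1} (\<lambda>t. z - c * t)" by (intro continuous_intros)
  then show "continuous_on {0..1} (\<lambda>t. g (z - c * t))"
    by (rule continuous_on_compose2[OF assms]) auto
qed

text \<open>In terms of an antiderivative \<open>P\<close> the average is
  \<open>(P x - P (x - a)) / a\<close>, so continuity of \<open>g\<close> suffices and nothing is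
  differentiated under the integral.\<close>

lemma has_real_derivative_average:
  fixes g :: "real \<Rightarrow> real"
  assumes g: "continuous_on UNIV g" and a: "a > 0"
  shows "((\<lambda>x. integral {0..1} (\<lambda>t. g (x - a * t))) has_real_derivative (g x - g (x - a)) / a) (at x)"
proof -
  have "isCont g x" for x using g by (simp add: continuous_on_eq_continuous_at)
  then obtain P where "\<And>x. (P has_vector_derivative g x) (at x)"
    using einterval_antiderivative[of "-\<infinity>" \<infinity> g] by auto
  then have P: "(P has_real_derivative g x) (at x)" for x
    by (simp add: has_real_derivative_iff_has_vector_derivative)
  have "integral {0..1} (\<lambda>t. g (x - a * t)) = (P x - P (x - a)) / a" for x
  proof (rule integral_unique)
    have "((\<lambda>t. - P (x - a * t) / a) has_real_derivative g (x - a * t)) (at t within {0..1})" for t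
    proof -
      have "((\<lambda>t. P (x - a * t)) has_real_derivative g (x - a * t) * (- a)) (at t within {0..1})"
        by (rule DERIV_chain2[OF P]) (auto intro!: derivative_eq_intros)
      from DERIV_cdivide[OF DERIV_minus[OF this], of a] show ?thesis using a by simp
    qed
    then have "((\<lambda>t. g (x - a * t)) has_integral (- P (x - a * 1) / a - (- P (x - a * 0) / a))) {0..1}"
      by (intro fundamental_theorem_of_calculus)
        (auto simp flip: has_real_derivative_iff_has_vector_derivative)
    then show "((\<lambda>t. g (x - a * t)) has_integral (P x - P (x - a)) / a) {0..1}"
      by (simp add: diff_divide_distrib)
  qed
  moreover have "((\<lambda>x. (P x - P (x - a)) / a) has_real_derivative (g x - g (x - a)) / a) (at x)"
  proof -
    have "((\<lambda>x. P (x - a)) has_real_derivative g (x - a) * 1) (at x)"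
      by (rule DERIV_chain2[OF P]) (auto intro!: derivative_eq_intros)
    from DERIV_cdivide[OF DERIV_diff[OF P this], of a] show ?thesis by simp
  qed
  ultimately show ?thesis by simp
qed

text \<open>As \<open>k\<close> grows this decreases to the second antiderivative of the infinite convolution of the
  normalised indicators of \<open>[0, a j]\<close>, \<open>j \<ge> n\<close>. Starting from a ramp makes all stages Lipschitz, so
  that pointwise limits suffice; the convolution itself (\<open>cascade\<close>) is recovered by two difference
  quotients.\<close>

fun ramp_avg :: "(nat \<Rightarrow> real) \<Rightarrow> nat \<Rightarrow> nat \<Rightarrow> real \<Rightarrow> real" where
  "ramp_avg a n 0 x = max 0 x"
| "ramp_avg a n (Suc k) x = integral {0..1} (\<lambda>t. ramp_avg a (Suc n) k (x - a n * t))"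

definition ramp_lim :: "(nat \<Rightarrow> real) \<Rightarrow> nat \<Rightarrow> real \<Rightarrow> real"
  where "ramp_lim a n x = lim (\<lambda>k. ramp_avg a n k x)"

definition diff_quot :: "real \<Rightarrow> (real \<Rightarrow> 'a::real_vector) \<Rightarrow> real \<Rightarrow> 'a"
  where "diff_quot h g x = (g x - g (x - h)) /\<^sub>R h"

lemma diff_quot_deriv:
  fixes g :: "real \<Rightarrow> 'a::real_normed_vector"
  assumes "\<And>x. (g has_vector_derivative g' x) (at x)"
  shows "(diff_quot h g has_vector_derivative diff_quot h g' x) (at x)"
proof -
  have "((\<lambda>x. g (x - h)) has_vector_derivative 1 *\<^sub>R g' (x - h)) (at x)"
    by (rule vector_diff_chain_at[of "\<lambda>x. x - h" 1 x g, unfolded o_def])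
      (auto simp: assms simp flip: has_real_derivative_iff_has_vector_derivative intro!: derivative_eq_intros)
  from bounded_linear.has_vector_derivative[OF bounded_linear_scaleR_right[of "inverse h"]
      has_vector_derivative_diff[OF assms this]]
  show ?thesis by (simp add: diff_quot_def[abs_def])
qed

text \<open>The distribution function of a sum of independent variables uniform on
  \<open>[0, a j]\<close>, \<open>j \<ge> n\<close>; \<open>cascade\<close> is its density. It is
  the derivative of \<open>ramp_lim a n\<close>, written as a difference quotient one level up so
  that it is visibly differentiable again.\<close>

definition cascade_cdf :: "(nat \<Rightarrow> real) \<Rightarrow> nat \<Rightarrow> real \<Rightarrow> real"
  where "cascade_cdf a n = diff_quot (a n) (ramp_lim a (Suc n))"

definition cascade :: "(nat \<Rightarrow> real) \<Rightarrow> nat \<Rightarrow> real \<Rightarrow> real"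
  where "cascade a n = diff_quot (a n) (cascade_cdf a (Suc n))"

locale scales =
  fixes a :: "nat \<Rightarrow> real"
  assumes pos: "0 < a n" and summ: "summable a"
begin

text \<open>The right end of the interval that carries \<open>cascade a n\<close>.\<close>

definition len :: "nat \<Rightarrow> real"
  where "len n = (\<Sum>k. a (n + k))"

lemma len_step: "len n = a n + len (Suc n)"
  using suminf_split_head[of "\<lambda>k. a (n + k)"] summable_iff_shift[of a n] summ
  by (simp add: len_def add.commute)

lemma len_pos: "0 < len n"
  unfolding len_def using summable_iff_shift[of a n] summ pos
  by (intro suminf_pos) (auto simp: add.commute)

text \<open>Averaging preserves monotonicity and slope at most one. Continuity is extracted from
  these bounds inside the induction, because the step needs the previous stage to be
  integrable.\<close>

lemma ramp_avg_Lipschitz: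
  "x \<le> y \<Longrightarrow> ramp_avg a n k x \<le> ramp_avg a n k y \<and> ramp_avg a n k y \<le> ramp_avg a n k x + (y - x)"
  and ramp_avg_continuous: "continuous_on UNIV (ramp_avg a n k)"
proof -
  have cont: "continuous_on S f"
    if "\<And>x y. x \<le> y \<Longrightarrow> f x \<le> f y \<and> f y \<le> f x + (y - x)" for f :: "real \<Rightarrow> real" and S
  proof -
    have "dist (f x) (f y) \<le> 1 * dist x y" for x y
      using that[of x y] that[of y x] by (cases "x \<le> y") (auto simp: dist_real_def)
    then have "1-lipschitz_on S f" by (auto intro: lipschitz_onI)
    then show ?thesis by (rule lipschitz_on_continuous_on)
  qed
  have L: "x \<le> y \<Longrightarrow> ramp_avg a n k x \<le> ramp_avg a n k y \<and> ramp_avg a n k y \<le> ramp_avg a n k x + (y - x)"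
    for x y n k
  proof (induction k arbitrary: n x y)
    case (Suc k)
    let ?g = "ramp_avg a (Suc n) k"
    have "continuous_on UNIV ?g" using Suc.IH by (intro cont)
    then have int: "(\<lambda>t. ?g (z - a n * t)) integrable_on {0..1}" for z
      by (rule integrable_affine_window)
    have IH: "?g (x - a n * t) \<le> ?g (y - a n * t)" "?g (y - a n * t) \<le> ?g (x - a n * t) + (y - x)" for t
      using Suc.IH[of "x - a n * t" "y - a n * t"] Suc.prems by auto
    have "integral {0..1} (\<lambda>t. ?g (x - a n * t)) \<le> integral {0..1} (\<lambda>t. ?g (y - a n * t))"
      by (intro integral_le int IH)
    moreover have "integral {0..1} (\<lambda>t. ?g (y - a n * t))
        \<le> integral {0..1} (\<lambda>t. ?g (x - a n * t) + (y - x))"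
      by (intro integral_le int integrable_add integrable_const_ivl IH)
    moreover have "\<dots> = integral {0..1} (\<lambda>t. ?g (x - a n * t)) + (y - x)"
      by (subst integral_add) (auto intro: int)
    ultimately show ?case by simp
  qed auto
  then show "x \<le> y \<Longrightarrow> ramp_avg a n k x \<le> ramp_avg a n k y \<and> ramp_avg a n k y \<le> ramp_avg a n k x + (y - x)" .
  show "continuous_on UNIV (ramp_avg a n k)" using L by (rule cont)
qed

lemma ramp_avg_integrable: "(\<lambda>t. ramp_avg a n k (z - c * t)) integrable_on {0..1}"
  by (rule integrable_affine_window[OF ramp_avg_continuous])

lemma ramp_avg_nonneg: "0 \<le> ramp_avg a n k x"
  by (induction k arbitrary: n x) (auto intro!: integral_nonneg ramp_avg_integrable)

lemma ramp_avg_nonpos: "x \<le> 0 \<Longrightarrow> ramp_avg a n k x = 0"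
proof (induction k arbitrary: n x)
  case (Suc k)
  have "ramp_avg a (Suc n) k (x - a n * t) = 0" if "t \<in> {0..1}" for t
    using Suc pos[of n] that by (auto intro!: Suc.IH order_trans[OF _ mult_nonneg_nonneg])
  then have "integral {0..1} (\<lambda>t. ramp_avg a (Suc n) k (x - a n * t)) = integral {0..1} (\<lambda>t::real. 0::real)"
    by (intro integral_cong)
  then show ?case by simp
qed auto

text \<open>Since \<open>len n = a n + len (Suc n)\<close>, all points of the window stay to the
  right of \<open>len (Suc n)\<close>, where the next level already has slope one.\<close>

lemma ramp_avg_slope_one:
  "len n \<le> x \<Longrightarrow> x \<le> y \<Longrightarrow> ramp_avg a n k y = ramp_avg a n k x + (y - x)"
proof (induction k arbitrary: n x y)
  case 0
  then show ?case using len_pos[of n] by auto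
next
  case (Suc k)
  let ?g = "ramp_avg a (Suc n) k"
  have "?g (y - a n * t) = ?g (x - a n * t) + (y - x)" if "t \<in> {0..1}" for t
  proof -
    have "a n * t \<le> a n" using that pos[of n] by (simp add: mult_left_le)
    then show ?thesis
      using Suc.IH[of "Suc n" "x - a n * t" "y - a n * t"] Suc.prems len_step[of n] by auto
  qed
  then have "integral {0..1} (\<lambda>t. ?g (y - a n * t)) = integral {0..1} (\<lambda>t. ?g (x - a n * t) + (y - x))"
    by (intro integral_cong)
  also have "\<dots> = integral {0..1} (\<lambda>t. ?g (x - a n * t)) + (y - x)"
    by (subst integral_add) (auto intro: ramp_avg_integrable)
  finally show ?case by simp
qed

text \<open>The window lies to the left of \<open>x\<close>, so averaging lowers the increasing
  ramp; later stages follow because the averaging operator is monotone.\<close>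

lemma ramp_avg_decreasing: "ramp_avg a n (Suc k) x \<le> ramp_avg a n k x"
proof (induction k arbitrary: n x)
  case 0
  have "ramp_avg a (Suc n) 0 (x - a n * t) \<le> max 0 x" if "t \<in> {0..1}" for t
  proof -
    have "0 \<le> a n * t" using that pos[of n] by simp
    then show ?thesis unfolding ramp_avg.simps by (intro max.mono) simp_all
  qed
  then have "integral {0..1} (\<lambda>t. ramp_avg a (Suc n) 0 (x - a n * t)) \<le> integral {0..1} (\<lambda>t::real. max 0 x)"
    by (intro integral_le ramp_avg_integrable) auto
  then show ?case by simp
next
  case (Suc k)
  have "integral {0..1} (\<lambda>t. ramp_avg a (Suc n) (Suc k) (x - a n * t))
      \<le> integral {0..1} (\<lambda>t. ramp_avg a (Suc n) k (x - a n * t))"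
    by (intro integral_le ramp_avg_integrable Suc.IH)
  then show ?case by simp
qed

lemma ramp_avg_le: "ramp_avg a n k x \<le> max 0 x"
proof (induction k)
  case (Suc k)
  then show ?case using ramp_avg_decreasing[of n k x] by linarith
qed auto

lemma ramp_avg_tendsto: "(\<lambda>k. ramp_avg a n k x) \<longlonglongrightarrow> ramp_lim a n x"
proof -
  have dec: "decseq (\<lambda>k. ramp_avg a n k x)"
    by (intro decseq_SucI ramp_avg_decreasing)
  have "convergent (\<lambda>k. ramp_avg a n k x)"
    by (rule decseq_convergent[OF dec, of 0]) (auto intro: ramp_avg_nonneg convergentI)
  then show ?thesis by (simp add: ramp_lim_def convergent_LIMSEQ_iff)
qed

lemma ramp_lim_Lipschitz:
  assumes "x \<le> y"
  shows "ramp_lim a n x \<le> ramp_lim a n y" "ramp_lim a n y \<le> ramp_lim a n x + (y - x)"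
proof -
  show "ramp_lim a n x \<le> ramp_lim a n y"
    using ramp_avg_Lipschitz[OF assms]
    by (intro LIMSEQ_le[OF ramp_avg_tendsto ramp_avg_tendsto]) auto
  show "ramp_lim a n y \<le> ramp_lim a n x + (y - x)"
    using ramp_avg_Lipschitz[OF assms]
    by (intro LIMSEQ_le[OF ramp_avg_tendsto tendsto_add[OF ramp_avg_tendsto tendsto_const]]) auto
qed

lemma ramp_lim_continuous: "continuous_on UNIV (ramp_lim a n)"
proof -
  have "dist (ramp_lim a n x) (ramp_lim a n y) \<le> 1 * dist x y" for x y
    using ramp_lim_Lipschitz[of x y n] ramp_lim_Lipschitz[of y x n]
    by (cases "x \<le> y") (auto simp: dist_real_def)
  then have "1-lipschitz_on UNIV (ramp_lim a n)" by (auto intro: lipschitz_onI)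
  then show ?thesis by (rule lipschitz_on_continuous_on)
qed

lemma ramp_lim_nonpos: "x \<le> 0 \<Longrightarrow> ramp_lim a n x = 0"
  by (simp add: ramp_lim_def ramp_avg_nonpos)

lemma ramp_lim_slope_one:
  assumes "len n \<le> x" "x \<le> y"
  shows "ramp_lim a n y = ramp_lim a n x + (y - x)"
proof (rule LIMSEQ_unique[OF ramp_avg_tendsto])
  have "(\<lambda>k. ramp_avg a n k x + (y - x)) \<longlonglongrightarrow> ramp_lim a n x + (y - x)"
    by (intro tendsto_intros ramp_avg_tendsto)
  then show "(\<lambda>k. ramp_avg a n k y) \<longlonglongrightarrow> ramp_lim a n x + (y - x)"
    by (simp add: ramp_avg_slope_one[OF assms])
qed

text \<open>Dominated convergence with the constant \<open>max 0 x\<close>. This identity links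
  level \<open>n\<close> to level \<open>Suc n\<close>, and all derivative formulas below rest on
  it.\<close>

lemma ramp_lim_average: "ramp_lim a n x = integral {0..1} (\<lambda>t. ramp_lim a (Suc n) (x - a n * t))"
proof (rule LIMSEQ_unique)
  show "(\<lambda>k. ramp_avg a n (Suc k) x) \<longlonglongrightarrow> ramp_lim a n x"
    by (rule LIMSEQ_Suc[OF ramp_avg_tendsto])
  have "(\<lambda>k. integral {0..1} (\<lambda>t. ramp_avg a (Suc n) k (x - a n * t)))
      \<longlonglongrightarrow> integral {0..1} (\<lambda>t. ramp_lim a (Suc n) (x - a n * t))"
  proof (rule dominated_convergence(2))
    show "(\<lambda>t::real. max 0 x) integrable_on {0..1}" by (rule integrable_const_ivl)
    show "norm (ramp_avg a (Suc n) k (x - a n * t)) \<le> max 0 x" if "t \<in> {0..1}" for k t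
    proof -
      have "ramp_avg a (Suc n) k (x - a n * t) \<le> max 0 (x - a n * t)" by (rule ramp_avg_le)
      also have "\<dots> \<le> max 0 x" using that pos[of n] by (intro max.mono) auto
      finally show ?thesis by (simp add: ramp_avg_nonneg)
    qed
  qed (auto intro: ramp_avg_integrable ramp_avg_tendsto)
  then show "(\<lambda>k. ramp_avg a n (Suc k) x)
      \<longlonglongrightarrow> integral {0..1} (\<lambda>t. ramp_lim a (Suc n) (x - a n * t))" by simp
qed

lemma ramp_lim_deriv: "(ramp_lim a n has_real_derivative cascade_cdf a n x) (at x)"
proof -
  have "ramp_lim a n = (\<lambda>x. integral {0..1} (\<lambda>t. ramp_lim a (Suc n) (x - a n * t)))"
    using ramp_lim_average by blast
  then show ?thesis
    using has_real_derivative_average[OF ramp_lim_continuous pos, of "Suc n" n x]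
    by (simp add: cascade_cdf_def diff_quot_def divide_inverse mult.commute)
qed

lemma cascade_cdf_deriv: "(cascade_cdf a n has_real_derivative cascade a n x) (at x)"
  unfolding cascade_cdf_def cascade_def has_real_derivative_iff_has_vector_derivative
  by (rule diff_quot_deriv)
    (use ramp_lim_deriv in \<open>simp add: has_real_derivative_iff_has_vector_derivative cascade_cdf_def\<close>)

text \<open>The refinement equation: differentiation becomes a difference quotient of the next
  level, which is what makes the cascade smooth.\<close>

lemma cascade_deriv:
  "(cascade a n has_vector_derivative diff_quot (a n) (cascade a (Suc n)) x) (at x)"
  unfolding cascade_def[of a n]
  by (rule diff_quot_deriv)
    (use cascade_cdf_deriv in \<open>simp add: has_real_derivative_iff_has_vector_derivative\<close>)

lemma cascade_cdf_bounds: "0 \<le> cascade_cdf a n x" "cascade_cdf a n x \<le> 1"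
  using ramp_lim_Lipschitz[of "x - a n" x "Suc n"] pos[of n]
  by (auto simp: cascade_cdf_def diff_quot_def field_simps)

lemma cascade_cdf_left: "x \<le> 0 \<Longrightarrow> cascade_cdf a n x = 0"
  using pos[of n] by (simp add: cascade_cdf_def diff_quot_def ramp_lim_nonpos)

lemma cascade_cdf_right: "len n \<le> x \<Longrightarrow> cascade_cdf a n x = 1"
  using ramp_lim_slope_one[of "Suc n" "x - a n" x] len_step[of n] pos[of n]
  by (simp add: cascade_cdf_def diff_quot_def)

lemma cascade_bound: "\<bar>cascade a n x\<bar> \<le> 1 / a n"
  using cascade_cdf_bounds[of "Suc n" x] cascade_cdf_bounds[of "Suc n" "x - a n"] pos[of n]
  by (auto simp: cascade_def diff_quot_def abs_mult field_simps)

lemma cascade_left: "x \<le> 0 \<Longrightarrow> cascade a n x = 0"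
  using pos[of n] by (simp add: cascade_def diff_quot_def cascade_cdf_left)

lemma cascade_right: "len n \<le> x \<Longrightarrow> cascade a n x = 0"
  using pos[of n] len_step[of n] by (simp add: cascade_def diff_quot_def cascade_cdf_right)

text \<open>Mean value theorem: the distribution function climbs from 0 to 1 across length
  \<open>len n\<close>.\<close>

lemma cascade_large: "\<exists>x. 0 < x \<and> x < len n \<and> cascade a n x = 1 / len n"
proof -
  obtain x where "0 < x" "x < len n"
      "cascade_cdf a n (len n) - cascade_cdf a n 0 = (len n - 0) * cascade a n x"
    using MVT2[of 0 "len n" "cascade_cdf a n" "cascade a n"] len_pos[of n] cascade_cdf_deriv by blast
  then show ?thesis
    using len_pos[of n] by (intro exI[of _ x]) (simp add: cascade_cdf_left cascade_cdf_right field_simps)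
qed

end

section \<open>Iterated difference quotients and the derivatives of the cascade\<close>

lemma epowr_ennreal: "0 \<le> r \<Longrightarrow> epowr (ennreal r) a = ennreal (r powr a)"
  by (simp add: epowr_def)

lemma epowr_cmult:
  assumes "0 < c" "0 < p"
  shows "epowr (ennreal (c powr p) * x) (1 / p) = ennreal c * epowr x (1 / p)"
proof (cases x)
  case (real r)
  have "epowr (ennreal (c powr p) * x) (1 / p) = epowr (ennreal (c powr p * r)) (1 / p)"
    using real by (simp add: ennreal_mult)
  also have "\<dots> = ennreal (c * r powr (1 / p))"
    using assms real by (simp add: epowr_ennreal powr_mult powr_powr)
  finally show ?thesis using assms real by (simp add: epowr_ennreal ennreal_mult)
next
  case top
  then show ?thesis using assms by (simp add: epowr_def ennreal_mult_top)
qed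

lemma Lp_qnorm_scaleR:
  assumes "0 < c" "0 < p" and [measurable]: "f \<in> borel_measurable borel"
  shows "Lp_qnorm p (\<lambda>x. c *\<^sub>R f x) = ennreal c * Lp_qnorm p f"
proof -
  have "(\<integral>\<^sup>+x. ennreal (norm (c *\<^sub>R f x) powr p) \<partial>lborel)
      = (\<integral>\<^sup>+x. ennreal (c powr p) * ennreal (norm (f x) powr p) \<partial>lborel)"
    using assms by (intro nn_integral_cong) (simp add: powr_mult ennreal_mult)
  also have "\<dots> = ennreal (c powr p) * (\<integral>\<^sup>+x. ennreal (norm (f x) powr p) \<partial>lborel)"
    by (intro nn_integral_cmult) auto
  finally show ?thesis unfolding Lp_qnorm_def using epowr_cmult assms by simp
qed

lemma Lp_qnorm_shift:
  assumes [measurable]: "f \<in> borel_measurable borel"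
  shows "Lp_qnorm p (\<lambda>x. f (x - h)) = Lp_qnorm p f"
proof -
  have "(\<lambda>x. ennreal (norm (f x) powr p)) \<in> borel_measurable borel" by measurable
  from nn_integral_real_affine[OF this, of 1 "- h"]
  show ?thesis by (simp add: Lp_qnorm_def)
qed

text \<open>The two shifted copies have equal quasinorm, so the quasi-triangle inequality costs
  exactly the factor \<open>2 powr (1 / p)\<close>.\<close>

lemma Lp_qnorm_diff_quot:
  assumes p: "0 < p" "p \<le> 1" and h: "0 < h" and f[measurable]: "f \<in> borel_measurable borel"
  shows "Lp_qnorm p (diff_quot h f) \<le> ennreal (2 powr (1 / p) / h) * Lp_qnorm p f"
proof -
  have "Lp_qnorm p (diff_quot h f) = ennreal (inverse h) * Lp_qnorm p (\<lambda>x. f x - f (x - h))"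
    unfolding diff_quot_def using p h by (intro Lp_qnorm_scaleR) auto
  also have "\<dots> \<le> ennreal (inverse h) * (ennreal (2 powr (1 / p)) * Lp_qnorm p f)"
    using Lp_qnorm_diff[OF p f, of "\<lambda>x. f (x - h)"] by (intro mult_left_mono) (simp_all add: Lp_qnorm_shift)
  also have "\<dots> = ennreal (inverse h * 2 powr (1 / p)) * Lp_qnorm p f"
    using h by (simp add: ennreal_mult mult.assoc)
  also have "inverse h * 2 powr (1 / p) = 2 powr (1 / p) / h"
    by (simp add: divide_inverse)
  finally show ?thesis .
qed

text \<open>The newest scale acts innermost. Differentiating \<open>cascade a n\<close> produces
  \<open>diff_quot (a n)\<close> at that position, so each derivative raises the index by
  one.\<close>

fun iter_quot :: "(nat \<Rightarrow> real) \<Rightarrow> nat \<Rightarrow> (real \<Rightarrow> complex) \<Rightarrow> real \<Rightarrow> complex" where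
  "iter_quot a 0 g = g"
| "iter_quot a (Suc n) g = iter_quot a n (diff_quot (a n) g)"

lemma iter_quot_deriv:
  "(\<And>x. (g has_vector_derivative g' x) (at x)) \<Longrightarrow>
    (iter_quot a n g has_vector_derivative iter_quot a n g' x) (at x)"
  by (induction n arbitrary: g g') (simp_all add: diff_quot_deriv)

lemma diff_quot_of_real:
  "diff_quot h (\<lambda>x. complex_of_real (g x)) = (\<lambda>x. complex_of_real (diff_quot h g x))"
  by (simp add: diff_quot_def scaleR_conv_of_real fun_eq_iff)

context scales
begin

lemma iter_quot_bound:
  "(\<And>x. norm (g x) \<le> B) \<Longrightarrow> norm (iter_quot a n g x) \<le> 2 ^ n * B / (\<Prod>j<n. a j)"
proof (induction n arbitrary: g B)
  case (Suc n)
  have "norm (diff_quot (a n) g x) \<le> 2 * B / a n" for x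
    using Suc.prems[of x] Suc.prems[of "x - a n"] norm_triangle_ineq4[of "g x" "g (x - a n)"] pos[of n]
    by (simp add: diff_quot_def divide_inverse mult.commute)
  from Suc.IH[OF this] show ?case by (simp add: mult_ac)
qed simp

text \<open>Of the \<open>2 ^ n\<close> shifted copies of \<open>g\<close> only the unshifted one is
  nonzero at \<open>x\<close>, because every shift moves \<open>x\<close> to a nonpositive
  point.\<close>

lemma iter_quot_first_piece:
  assumes "\<And>x. x \<le> 0 \<Longrightarrow> g x = 0" "\<And>j. j < n \<Longrightarrow> x \<le> a j"
  shows "iter_quot a n g x = g x /\<^sub>R (\<Prod>j<n. a j)"
  using assms
proof (induction n arbitrary: g)
  case (Suc n)
  have "diff_quot (a n) g y = 0" if "y \<le> 0" for y
    using that pos[of n] by (simp add: diff_quot_def Suc.prems)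
  moreover have "diff_quot (a n) g x = g x /\<^sub>R a n"
    using Suc.prems by (simp add: diff_quot_def)
  ultimately show ?case using Suc.IH[of "diff_quot (a n) g"] Suc.prems by simp
qed simp

lemma Lp_qnorm_iter_quot:
  assumes p: "0 < p" "p \<le> 1"
  shows "g \<in> borel_measurable borel \<Longrightarrow>
    Lp_qnorm p (iter_quot a n g) \<le> ennreal ((2 powr (1 / p)) ^ n / (\<Prod>j<n. a j)) * Lp_qnorm p g"
proof (induction n arbitrary: g)
  case (Suc n)
  note [measurable] = Suc.prems
  let ?c = "2 powr (1 / p)"
  have P: "0 < (\<Prod>j<n. a j)" using pos by (simp add: prod_pos)
  have "diff_quot (a n) g \<in> borel_measurable borel"
    unfolding diff_quot_def by measurable
  from Suc.IH[OF this]
  have "Lp_qnorm p (iter_quot a (Suc n) g)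
      \<le> ennreal (?c ^ n / (\<Prod>j<n. a j)) * Lp_qnorm p (diff_quot (a n) g)" by simp
  also have "\<dots> \<le> ennreal (?c ^ n / (\<Prod>j<n. a j)) * (ennreal (?c / a n) * Lp_qnorm p g)"
    by (intro mult_left_mono Lp_qnorm_diff_quot p pos Suc.prems) auto
  also have "\<dots> = ennreal (?c ^ Suc n / (\<Prod>j<Suc n. a j)) * Lp_qnorm p g"
    using P pos[of n] by (simp add: mult_ac flip: ennreal_mult mult.assoc)
  finally show ?case .
qed simp

lemma nderiv_cascade:
  "nderiv n (\<lambda>x. complex_of_real (cascade a 0 x)) = iter_quot a n (\<lambda>x. complex_of_real (cascade a n x))"
  and cascade_smooth: "smooth (\<lambda>x. complex_of_real (cascade a 0 x))"
proof -
  let ?c = "\<lambda>n x. complex_of_real (cascade a n x)"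
  have d: "(?c n has_vector_derivative diff_quot (a n) (?c (Suc n)) x) (at x)" for n x
    using bounded_linear.has_vector_derivative[OF bounded_linear_of_real cascade_deriv]
    by (simp add: diff_quot_of_real)
  have D: "(iter_quot a n (?c n) has_vector_derivative iter_quot a (Suc n) (?c (Suc n)) x) (at x)" for n x
    using iter_quot_deriv[OF d] by simp
  have nd: "nderiv n (?c 0) = iter_quot a n (?c n)" for n
  proof (induction n)
    case 0
    show ?case by (simp add: nderiv_def)
  next
    case (Suc n)
    show ?case
    proof
      fix x
      show "nderiv (Suc n) (?c 0) x = iter_quot a (Suc n) (?c (Suc n)) x"
        unfolding nderiv_Suc Suc.IH by (rule vector_derivative_at[OF D])
    qed
  qed
  then show "nderiv n (?c 0) = iter_quot a n (?c n)" .
  show "smooth (?c 0)"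
    using D by (auto simp: smooth_def nd intro: differentiableI_vector)
qed

text \<open>Comparison with a rectangle of height \<open>1 / a n\<close> over
  \<open>[0, len n]\<close>.\<close>

lemma Lp_qnorm_cascade:
  assumes p: "0 < p"
  shows "Lp_qnorm p (\<lambda>x. complex_of_real (cascade a n x)) \<le> ennreal (len n powr (1 / p) / a n)"
proof -
  have "(\<integral>\<^sup>+x. ennreal (norm (complex_of_real (cascade a n x)) powr p) \<partial>lborel)
      \<le> (\<integral>\<^sup>+x. ennreal ((1 / a n) powr p) * indicator {0..len n} x \<partial>lborel)"
  proof (intro nn_integral_mono)
    fix x
    show "ennreal (norm (complex_of_real (cascade a n x)) powr p)
        \<le> ennreal ((1 / a n) powr p) * indicator {0..len n} x"
      using cascade_left[of x n] cascade_right[of n x] cascade_bound[of n x] p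
      by (auto simp: indicator_def intro!: ennreal_leI powr_mono2)
  qed
  also have "\<dots> = ennreal (len n * (1 / a n) powr p)"
    using len_pos[of n] by (simp add: nn_integral_cmult_indicator ennreal_mult mult.commute)
  finally have "Lp_qnorm p (\<lambda>x. complex_of_real (cascade a n x))
      \<le> epowr (ennreal (len n * (1 / a n) powr p)) (1 / p)"
    unfolding Lp_qnorm_def using p by (intro epowr_mono) auto
  also have "\<dots> = ennreal (len n powr (1 / p) / a n)"
    using len_pos[of n] pos[of n] p by (simp add: epowr_ennreal powr_mult powr_powr)
  finally show ?thesis .
qed

lemma Lp_qnorm_nderiv_cascade:
  assumes p: "0 < p" "p \<le> 1"
  shows "Lp_qnorm p (nderiv n (\<lambda>x. complex_of_real (cascade a 0 x)))
    \<le> ennreal ((2 powr (1 / p)) ^ n / (\<Prod>j<n. a j) * (len n powr (1 / p) / a n))"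
proof -
  let ?c = "\<lambda>n x. complex_of_real (cascade a n x)"
  have P: "0 < (\<Prod>j<n. a j)" using pos by (simp add: prod_pos)
  have "?c n \<in> borel_measurable borel"
    using cascade_deriv[of n]
    by (intro borel_measurable_continuous_onI continuous_at_imp_continuous_on ballI continuous_of_real)
      (auto dest: has_vector_derivative_continuous)
  then have "Lp_qnorm p (nderiv n (?c 0)) \<le>
      ennreal ((2 powr (1 / p)) ^ n / (\<Prod>j<n. a j)) * Lp_qnorm p (?c n)"
    unfolding nderiv_cascade by (rule Lp_qnorm_iter_quot[OF p])
  also have "\<dots> \<le> ennreal ((2 powr (1 / p)) ^ n / (\<Prod>j<n. a j)) * ennreal (len n powr (1 / p) / a n)"
    by (intro mult_left_mono Lp_qnorm_cascade p) auto
  also have "\<dots> = ennreal ((2 powr (1 / p)) ^ n / (\<Prod>j<n. a j) * (len n powr (1 / p) / a n))"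
    using P pos[of n] by (intro ennreal_mult[symmetric]) (auto intro!: divide_nonneg_nonneg)
  finally show ?thesis .
qed

lemma norm_nderiv_cascade_le:
  "norm (nderiv n (\<lambda>x. complex_of_real (cascade a 0 x)) x) \<le> 2 ^ n * (1 / a n) / (\<Prod>j<n. a j)"
  unfolding nderiv_cascade by (rule iter_quot_bound) (use cascade_bound in auto)

text \<open>The assumption puts the whole support of the unshifted copy to the left of all shifts,
  so its large value from \<open>cascade_large\<close> survives without cancellation.\<close>

lemma norm_nderiv_cascade_ge:
  assumes "\<And>j. j < n \<Longrightarrow> len n \<le> a j"
  shows "\<exists>x. norm (nderiv n (\<lambda>x. complex_of_real (cascade a 0 x)) x) = 1 / len n / (\<Prod>j<n. a j)"
proof -
  have P: "0 < (\<Prod>j<n. a j)" using pos by (simp add: prod_pos)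
  obtain x where x: "0 < x" "x < len n" "cascade a n x = 1 / len n"
    using cascade_large by blast
  have "nderiv n (\<lambda>x. complex_of_real (cascade a 0 x)) x = complex_of_real (cascade a n x) /\<^sub>R (\<Prod>j<n. a j)"
    unfolding nderiv_cascade
    by (rule iter_quot_first_piece) (use assms x in \<open>force simp: cascade_left\<close>)+
  then show ?thesis
    using x P len_pos[of n] by (intro exI[of _ x]) (simp add: norm_divide inverse_eq_divide)
qed

end

section \<open>Growth rates and closedness of the test class\<close>

lemma eln_le: "x \<le> ennreal (exp v) \<Longrightarrow> eln x \<le> ereal v"
proof (cases x)
  case (real r)
  assume "x \<le> ennreal (exp v)"
  then have "r \<le> exp v" using real by simp
  then have "ln r \<le> v" if "0 < r" using that by (metis ln_exp ln_le_cancel_iff exp_gt_zero)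
  then show ?thesis using real by (auto simp: eln_def)
qed (simp add: top_unique)

lemma eln_ge: "ennreal (exp v) \<le> x \<Longrightarrow> ereal v \<le> eln x"
proof (cases x)
  case (real r)
  assume "ennreal (exp v) \<le> x"
  then have "exp v \<le> r" using real by simp
  moreover from this have "0 < r" by (rule less_le_trans[OF exp_gt_zero])
  ultimately have "v \<le> ln r" by (simp add: ln_ge_iff)
  then show ?thesis using real \<open>0 < r\<close> by (simp add: eln_def)
qed (simp add: eln_def)

lemma eln_less: "eln x < ereal v \<Longrightarrow> x \<le> ennreal (exp v)"
  using eln_ge[of v x] by (metis leD linear)

lemma limsup_growth_le:
  assumes "0 < q"
    and "\<And>n x. norm (nderiv n f x) \<le> exp (v n)" and "(\<lambda>n. q ^ n * v n) \<longlonglongrightarrow> T"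
  shows "limsup (\<lambda>n. ereal (q ^ n) * eln (sup_norm (nderiv n f))) \<le> ereal T"
proof -
  have "ereal (q ^ n) * eln (sup_norm (nderiv n f)) \<le> ereal (q ^ n * v n)" for n
  proof -
    have "sup_norm (nderiv n f) \<le> ennreal (exp (v n))"
      unfolding sup_norm_def using assms(2) by (intro SUP_least ennreal_leI)
    then have "ereal (q ^ n) * eln (sup_norm (nderiv n f)) \<le> ereal (q ^ n) * ereal (v n)"
      using assms(1) by (intro ereal_mult_left_mono eln_le) auto
    then show ?thesis by simp
  qed
  then have "limsup (\<lambda>n. ereal (q ^ n) * eln (sup_norm (nderiv n f))) \<le> limsup (\<lambda>n. ereal (q ^ n * v n))"
    by (intro Limsup_mono always_eventually allI)
  also have "\<dots> = ereal T"
    using assms(3) by (intro lim_imp_Limsup) auto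
  finally show ?thesis .
qed

lemma test_class_growth:
  assumes p: "p < 1" and f: "f \<in> test_class p \<theta> M" and T: "\<theta> < T"
  shows "\<forall>\<^sub>F n in sequentially. \<forall>x. norm (nderiv n f x) \<le> exp (T / (1 - p) ^ n)"
proof -
  have "limsup (\<lambda>n. ereal ((1 - p) ^ n) * eln (sup_norm (nderiv n f))) < ereal T"
    using f T by (auto simp: test_class_def intro: le_less_trans)
  from Limsup_lessD[OF this]
  show ?thesis
  proof eventually_elim
    case (elim n)
    have q: "0 < (1 - p) ^ n" using p by simp
    have "eln (sup_norm (nderiv n f)) < ereal (T / (1 - p) ^ n)"
      using elim q p by (cases "eln (sup_norm (nderiv n f))") (auto simp: field_simps zero_ereal_def split: if_splits)
    then have le: "sup_norm (nderiv n f) \<le> ennreal (exp (T / (1 - p) ^ n))" by (rule eln_less)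
    then show ?case by (simp add: sup_norm_def SUP_le_iff)
  qed
qed

text \<open>The partial sums may fail to be monotone when \<open>ln (M j) < 0\<close>. Subtracting
  the convergent \<open>ln (M 0) * g n\<close> leaves an increasing sequence, for which a limsup
  below infinity yields a limit.\<close>

lemma p_characteristic_convergent:
  assumes p: "0 < p" "p < 1" and M: "weight_sequence M" "incseq M" and fin: "p_characteristic p M < \<infinity>"
  obtains S where "(\<lambda>n. \<Sum>j=1..n. (1 - p) ^ j * ln (M j)) \<longlonglongrightarrow> S"
proof -
  define q where "q = 1 - p"
  have q: "0 < q" "q < 1" using p by (auto simp: q_def)
  define s where "s n = (\<Sum>j=1..n. q ^ j * ln (M j))" for n
  define g where "g n = (\<Sum>j=1..n. q ^ j)" for n
  define t where "t n = s n - ln (M 0) * g n" for n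
  have "summable (\<lambda>k. q ^ Suc k)" using q by (simp add: summable_geometric)
  then have "convergent (\<lambda>n. \<Sum>k<n. q ^ Suc k)" by (simp only: summable_iff_convergent)
  then have g: "convergent g"
    unfolding g_def[abs_def] by (simp only: One_nat_def sum.atLeast1_atMost_eq)
  then obtain B where B: "\<And>n. \<bar>g n\<bar> \<le> B"
    using convergent_imp_Bseq[of g] by (auto simp: Bseq_def)
  have t_eq: "t n = (\<Sum>j=1..n. q ^ j * (ln (M j) - ln (M 0)))" for n
    by (simp add: t_def s_def g_def sum_distrib_left sum_subtractf algebra_simps)
  have lnM: "ln (M 0) \<le> ln (M j)" for j
    using M by (simp add: weight_sequence_def incseq_def)
  have inc: "incseq t"
    using lnM q by (intro incseq_SucI) (simp add: t_eq)
  have "limsup (\<lambda>n. ereal (s n)) < \<infinity>"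
    using fin by (simp add: p_characteristic_def s_def q_def)
  then obtain K where "limsup (\<lambda>n. ereal (s n)) < ereal K"
    using less_PInf_Ex_of_nat by (metis ereal_less_PInfty less_ereal.simps(1) ereal_dense2)
  from Limsup_lessD[OF this] obtain n0 where n0: "\<And>n. n \<ge> n0 \<Longrightarrow> s n < K"
    by (auto simp: eventually_sequentially)
  \<comment> \<open>The bound on \<open>s\<close> holds only from \<open>n0\<close> on; monotonicity
    of \<open>t\<close> carries it back to smaller indices.\<close>
  have "t n \<le> K + \<bar>ln (M 0)\<bar> * B" for n
  proof -
    have "\<bar>ln (M 0) * g (max n n0)\<bar> \<le> \<bar>ln (M 0)\<bar> * B"
      using B by (auto simp: abs_mult intro: mult_left_mono)
    then have "t (max n n0) \<le> K + \<bar>ln (M 0)\<bar> * B"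
      using n0[of "max n n0"] by (auto simp: t_def)
    then show ?thesis using incseqD[OF inc, of n "max n n0"] by simp
  qed
  then obtain L where "t \<longlonglongrightarrow> L"
    using incseq_convergent[OF inc] by blast
  then have "convergent (\<lambda>n. t n + ln (M 0) * g n)"
    using g by (intro convergent_add convergent_mult convergent_const) (auto simp: convergent_def)
  then show ?thesis using that by (auto simp: t_def convergent_def s_def q_def)
qed

text \<open>\<open>nderiv_bound\<close> is used twice. For \<open>u n\<close> it gives the sharp
  exponent, any \<open>T > \<theta>\<close>, with a constant independent of \<open>n\<close>; for
  \<open>u n - f\<close> the exponent is crude, but the constant tends to 0.\<close>

lemma test_class_closed:
  assumes p: "0 < p" "p < 1" and M: "weight_sequence M"
    and conv: "(\<lambda>n. \<Sum>j=1..n. (1 - p) ^ j * ln (M j)) \<longlonglongrightarrow> S"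
    and u: "\<And>n. u n \<in> test_class p \<theta> M" and f: "f \<in> test_class p \<theta>' M"
    and lim: "(\<lambda>n. carleman_qnorm p M (\<lambda>x. u n x - f x)) \<longlonglongrightarrow> 0"
  shows "f \<in> test_class p \<theta> M"
proof -
  define q where "q = 1 - p"
  have q: "0 < q" "q < 1" using p by (auto simp: q_def)
  define s where "s n = (\<Sum>j=1..n. q ^ j * ln (M j))" for n
  have s: "s \<longlonglongrightarrow> S" using conv by (simp add: s_def[abs_def] q_def)
  define E where "E T k = (T + p / q * (S - s k)) / q ^ k" for T k
  have Mpos: "\<And>n. 0 < M n" using M by (simp add: weight_sequence_def)
  note bound = nderiv_bound[OF p Mpos conv, folded q_def, folded s_def, folded E_def]
  have sm: "smooth f" "\<And>n. smooth (u n)" using f u by (auto simp: test_class_def)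
  obtain A1 where A1: "0 \<le> A1" "carleman_qnorm p M f = ennreal A1"
    using f by (cases "carleman_qnorm p M f") (auto simp: test_class_def)
  \<comment> \<open>Bounds the quasinorm of \<open>u n = (u n - f) - (0 - f)\<close> once that of
    \<open>u n - f\<close> is at most 1.\<close>
  define A where "A = 2 powr (1 / p) * max A1 1"
  have A: "0 < A" by (auto simp: A_def)
  \<comment> \<open>One unit gives strict room above both parameters; the other absorbs the factor 2
    from adding two bounds, as \<open>2 \<le> exp (1 / q ^ k)\<close>.\<close>
  define T' where "T' = max \<theta> \<theta>' + 2"
  have close: "\<forall>\<^sub>F n in sequentially. carleman_qnorm p M (\<lambda>x. u n x - f x) \<le> ennreal \<epsilon>"
    if "0 < \<epsilon>" for \<epsilon>
    using order_tendstoD(2)[OF lim, of "ennreal \<epsilon>"] that by (auto elim: eventually_mono)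
  have grow_diff: "\<forall>\<^sub>F k in sequentially. \<forall>x. norm (nderiv k (\<lambda>x. u n x - f x) x) \<le> exp (T' / q ^ k)" for n
  proof -
    let ?T = "max \<theta> \<theta>' + 1"
    have "\<forall>\<^sub>F k in sequentially. \<forall>x. norm (nderiv k (u n) x) \<le> exp (?T / q ^ k)"
      "\<forall>\<^sub>F k in sequentially. \<forall>x. norm (nderiv k f x) \<le> exp (?T / q ^ k)"
      unfolding q_def by (intro test_class_growth[OF p(2) u] test_class_growth[OF p(2) f]; simp)+
    then show ?thesis
    proof eventually_elim
      case (elim k)
      have "1 \<le> 1 / q ^ k" using q by (simp add: power_le_one)
      then have "2 \<le> exp (1 / q ^ k)" using exp_ge_add_one_self[of "1 / q ^ k"] by linarith
      then have "2 * exp (?T / q ^ k) \<le> exp (1 / q ^ k) * exp (?T / q ^ k)"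
        by (intro mult_right_mono) auto
      also have "\<dots> = exp (T' / q ^ k)"
        by (simp add: T'_def add_divide_distrib flip: exp_add)
      finally have *: "2 * exp (?T / q ^ k) \<le> exp (T' / q ^ k)" .
      show ?case
      proof
        fix x
        have "norm (nderiv k (\<lambda>x. u n x - f x) x) \<le> norm (nderiv k (u n) x) + norm (nderiv k f x)"
          by (simp add: nderiv_diff[OF sm(2) sm(1)] norm_triangle_ineq4)
        then show "norm (nderiv k (\<lambda>x. u n x - f x) x) \<le> exp (T' / q ^ k)"
          using elim[THEN spec, of x] * by linarith
      qed
    qed
  qed
  have key: "norm (nderiv k f x) \<le> A * exp (E T k)" if T: "\<theta> < T" for T k x
  proof (rule field_le_epsilon)
    fix \<delta> :: real assume "0 < \<delta>"
    define \<epsilon> where "\<epsilon> = \<delta> / exp (E T' k)"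
    have "0 < \<epsilon>" using \<open>0 < \<delta>\<close> by (simp add: \<epsilon>_def)
    obtain n where n: "carleman_qnorm p M (\<lambda>x. u n x - f x) \<le> ennreal \<epsilon>"
        "carleman_qnorm p M (\<lambda>x. u n x - f x) \<le> ennreal 1"
      using eventually_happens'[OF sequentially_bot eventually_conj[OF close[OF \<open>0 < \<epsilon>\<close>] close[of 1]]]
      by auto
    have "carleman_qnorm p M (\<lambda>x. (u n x - f x) - (0 - f x))
        \<le> ennreal (2 powr (1 / p)) * max (carleman_qnorm p M (\<lambda>x. u n x - f x)) (carleman_qnorm p M (\<lambda>x. 0 - f x))"
      using p smooth_diff[OF sm(1) sm(1)] by (intro carleman_qnorm_diff smooth_diff sm) auto
    also have "carleman_qnorm p M (\<lambda>x. 0 - f x) = carleman_qnorm p M f"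
      using carleman_qnorm_commute[OF smooth_diff[OF sm(1) sm(1)] sm(1), of p M] by simp
    also have "ennreal (2 powr (1 / p)) * max (carleman_qnorm p M (\<lambda>x. u n x - f x)) (carleman_qnorm p M f)
        \<le> ennreal (2 powr (1 / p)) * ennreal (max A1 1)"
    proof -
      have "carleman_qnorm p M (\<lambda>x. u n x - f x) \<le> ennreal (max A1 1)"
        by (rule order_trans[OF n(2)]) (intro ennreal_leI, simp)
      moreover have "carleman_qnorm p M f \<le> ennreal (max A1 1)"
        unfolding A1(2) by (intro ennreal_leI) simp
      ultimately show ?thesis by (intro mult_left_mono) simp_all
    qed
    also have "\<dots> = ennreal A" by (simp add: A_def ennreal_mult)
    finally have "carleman_qnorm p M (u n) \<le> ennreal A" by simp
    moreover have "\<forall>\<^sub>F j in sequentially. \<forall>x. norm (nderiv j (u n) x) \<le> exp (T / q ^ j)"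
      unfolding q_def by (rule test_class_growth[OF p(2) u T])
    ultimately have "norm (nderiv k (u n) x) \<le> A * exp (E T k)"
      by (intro bound sm A)
    moreover have "norm (nderiv k (\<lambda>x. u n x - f x) x) \<le> \<epsilon> * exp (E T' k)"
      by (intro bound smooth_diff sm n(1) \<open>0 < \<epsilon>\<close> grow_diff)
    moreover have "norm (nderiv k f x) \<le> norm (nderiv k (u n) x) + norm (nderiv k (\<lambda>x. u n x - f x) x)"
      by (simp add: nderiv_diff[OF sm(2) sm(1)] norm_triangle_sub norm_minus_commute)
    ultimately show "norm (nderiv k f x) \<le> A * exp (E T k) + \<delta>"
      by (simp add: \<epsilon>_def)
  qed
  have "limsup (\<lambda>n. ereal (q ^ n) * eln (sup_norm (nderiv n f))) \<le> ereal T" if T: "\<theta> < T" for T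
  proof (rule limsup_growth_le[OF q(1)])
    show "norm (nderiv n f x) \<le> exp (ln A + E T n)" for n x
      using key[OF T] A by (simp add: exp_add)
    \<comment> \<open>The factor \<open>q ^ n\<close> removes the constant \<open>A\<close>, and
      convergence of the characteristic removes \<open>S - s n\<close>; only \<open>T\<close>
      remains.\<close>
    have "(\<lambda>n. q ^ n * ln A + (T + p / q * (S - s n))) \<longlonglongrightarrow> 0 * ln A + (T + p / q * (S - S))"
      using q by (intro tendsto_intros s LIMSEQ_power_zero) auto
    moreover have "q ^ n * (ln A + E T n) = q ^ n * ln A + (T + p / q * (S - s n))" for n
      using q by (simp add: E_def field_simps)
    ultimately show "(\<lambda>n. q ^ n * (ln A + E T n)) \<longlonglongrightarrow> T" by simp
  qed
  note * = this
  have "limsup (\<lambda>n. ereal (q ^ n) * eln (sup_norm (nderiv n f))) \<le> ereal \<theta>"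
  proof (rule ereal_le_epsilon2)
    fix e :: real assume "0 < e"
    then show "limsup (\<lambda>n. ereal (q ^ n) * eln (sup_norm (nderiv n f))) \<le> ereal \<theta> + ereal e"
      using *[of "\<theta> + e"] by simp
  qed
  then show ?thesis using f by (simp add: test_class_def q_def)
qed

section \<open>A function with prescribed growth of its derivatives\<close>

text \<open>The scales are chosen so that the loss \<open>2 powr (1 / p)\<close> and the division by \<open>a n\<close> in every
  difference quotient are exactly balanced by the shrinking support; the exponents telescope
  because \<open>p * r ^ n = q * (r ^ Suc n - r ^ n)\<close> for \<open>q = 1 - p\<close>, \<open>r = 1 / q\<close>.\<close>

lemma extremal_function:
  fixes p \<theta> :: real
  assumes p: "0 < p" "p < 1" and \<theta>: "0 < \<theta>"
  obtains f C u l where "smooth f" "0 < C" "\<And>n. Lp_qnorm p (nderiv n f) \<le> ennreal C"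
    "\<And>n x. norm (nderiv n f x) \<le> exp (u n)" "(\<lambda>n. (1 - p) ^ n * u n) \<longlonglongrightarrow> \<theta>"
    "\<forall>\<^sub>F n in sequentially. \<exists>x. exp (l n) \<le> norm (nderiv n f x)" "(\<lambda>n. (1 - p) ^ n * l n) \<longlonglongrightarrow> \<theta>"
proof -
  define q r b where "q = 1 - p" and "r = 1 / q" and "b = ln 2 / p"
  have q: "0 < q" "q < 1" and r: "1 < r" and qr: "q * r = 1" and p_eq: "p = 1 - q"
    using p by (auto simp: q_def r_def)
  \<comment> \<open>Here \<open>exp b = 2 powr (1 / p)\<close> cancels the loss of one difference
    quotient.\<close>
  define a where "a n = exp (b - \<theta> * p * r ^ n)" for n
  define \<rho> where "\<rho> = exp (- (\<theta> * p * (r - 1)))"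
  have \<rho>: "0 < \<rho>" "\<rho> < 1" using \<theta> p r by (auto simp: \<rho>_def)
  have apos: "0 < a n" for n by (simp add: a_def)
  \<comment> \<open>Turns the doubly exponential decay into geometric decay with one ratio
    \<open>\<rho>\<close> for all starting indices, so the tail \<open>len n\<close> is comparable
    to its first term.\<close>
  have bern: "1 + real j * (r - 1) \<le> r ^ j" for j
    using Bernoulli_inequality[of "r - 1" j] r by simp
  have decay: "a (n + j) \<le> \<rho> ^ j * a n" for n j
  proof -
    have "1 * (real j * (r - 1)) \<le> r ^ n * (r ^ j - 1)"
      using bern[of j] r by (intro mult_mono) (auto simp: one_le_power)
    then have "\<theta> * p * (real j * (r - 1)) \<le> \<theta> * p * (r ^ n * (r ^ j - 1))"
      using \<theta> p by (intro mult_left_mono) auto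
    then have "b - \<theta> * p * r ^ (n + j) \<le> real j * - (\<theta> * p * (r - 1)) + (b - \<theta> * p * r ^ n)"
      by (simp add: power_add algebra_simps)
    then show ?thesis
      by (simp only: a_def \<rho>_def exp_of_nat_mult[symmetric] exp_add[symmetric] exp_le_cancel_iff)
  qed
  have geo: "summable (\<lambda>j. \<rho> ^ j)" using \<rho> by (simp add: summable_geometric)
  have "summable a"
  proof (rule summable_comparison_test')
    show "summable (\<lambda>j. \<rho> ^ j * a 0)" using geo by (rule summable_mult2)
    show "norm (a j) \<le> \<rho> ^ j * a 0" for j using decay[of 0 j] apos[of j] by simp
  qed
  then interpret scales a using apos by unfold_locales
  define K where "K = 1 / (1 - \<rho>)"
  have K: "0 < K" using \<rho> by (simp add: K_def)
  have len_le: "len n \<le> K * a n" for n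
  proof -
    have "len n \<le> (\<Sum>j. \<rho> ^ j * a n)"
      unfolding len_def using summable_iff_shift[of a n] \<open>summable a\<close>
      by (intro suminf_le decay summable_mult2 geo) (simp add: add.commute)
    also have "\<dots> = K * a n"
      using \<rho> geo by (simp add: suminf_mult2[symmetric] suminf_geometric K_def)
    finally show ?thesis .
  qed
  \<comment> \<open>The logarithm of the product of the first \<open>n\<close> scales; the geometric
    sum of \<open>p * r ^ j\<close> over \<open>j < n\<close> is
    \<open>q * (r ^ n - 1)\<close>.\<close>
  define c where "c n = real n * b - \<theta> * q * (r ^ n - 1)" for n
  have prod: "(\<Prod>j<n. a j) = exp (c n)" for n
  proof (induction n)
    case (Suc n)
    have "c n + (b - \<theta> * p * r ^ n) = c (Suc n)"
    proof -
      have "q * r ^ Suc n = r ^ n" using qr by (simp flip: mult.assoc)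
      then have "\<theta> * q * r ^ Suc n = \<theta> * r ^ n" by simp
      then show ?thesis by (simp add: c_def p_eq algebra_simps)
    qed
    then show ?case by (simp add: Suc.IH) (simp add: a_def flip: exp_add)
  qed (simp add: c_def)
  define f where "f x = complex_of_real (cascade a 0 x)" for x
  \<comment> \<open>In the logarithm of the quasinorm bound the term
    \<open>\<theta> * q * r ^ n\<close> from the product cancels against the one from
    \<open>len n powr (1 / p) / a n\<close>, and \<open>n * b\<close> cancels as well; these
    constants are left.\<close>
  define C where "C = exp (ln K / p + b * q / p - \<theta> * q)"
  \<comment> \<open>\<open>u\<close> and \<open>l\<close> are logarithms of the upper and lower
    bounds for the suprema, the latter with \<open>len n\<close> replaced by \<open>K * a n\<close>.
    They share the leading term \<open>\<theta> * r ^ n\<close>; the rest is affine in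
    \<open>n\<close> and disappears after multiplication by \<open>q ^ n\<close>.\<close>
  define u where "u n = real n * (ln 2 - b) - b - \<theta> * q + \<theta> * r ^ n" for n
  define l where "l n = - real n * b - ln K - b - \<theta> * q + \<theta> * r ^ n" for n
  have lim: "(\<lambda>n. (1 - p) ^ n * (real n * A + B + \<theta> * r ^ n)) \<longlonglongrightarrow> \<theta>" for A B
  proof -
    have "(\<lambda>n. (real n * q ^ n) * A + q ^ n * B + \<theta>) \<longlonglongrightarrow> 0 * A + 0 * B + \<theta>"
      using q by (intro tendsto_intros LIMSEQ_power_zero powser_times_n_limit_0) auto
    moreover have "q ^ n * (real n * A + B + \<theta> * r ^ n) = (real n * q ^ n) * A + q ^ n * B + \<theta>" for n
      using qr by (simp add: algebra_simps flip: power_mult_distrib)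
    ultimately show ?thesis by (simp add: q_def)
  qed
  have "smooth f" unfolding f_def[abs_def] by (rule cascade_smooth)
  moreover have "0 < C" by (simp add: C_def)
  moreover have "Lp_qnorm p (nderiv n f) \<le> ennreal C" for n
  proof -
    have "Lp_qnorm p (nderiv n f) \<le> ennreal ((2 powr (1 / p)) ^ n / (\<Prod>j<n. a j) * (len n powr (1 / p) / a n))"
      unfolding f_def[abs_def] using p by (intro Lp_qnorm_nderiv_cascade) auto
    also have "\<dots> \<le> ennreal C"
    proof (rule ennreal_leI)
      have two: "(2 powr (1 / p)) ^ n = exp (real n * b)"
        by (simp add: powr_def b_def flip: exp_of_nat_mult)
      have "len n powr (1 / p) \<le> (K * a n) powr (1 / p)"
        using len_le[of n] len_pos[of n] p by (intro powr_mono2) auto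
      also have "\<dots> = exp ((ln K + (b - \<theta> * p * r ^ n)) / p)"
        using K by (simp add: powr_def ln_mult a_def)
      finally have "len n powr (1 / p) \<le> exp ((ln K + (b - \<theta> * p * r ^ n)) / p)" .
      then have "(2 powr (1 / p)) ^ n / (\<Prod>j<n. a j) * (len n powr (1 / p) / a n)
          \<le> exp (real n * b) / (\<Prod>j<n. a j) * (exp ((ln K + (b - \<theta> * p * r ^ n)) / p) / a n)"
        unfolding two using apos[of n] by (intro mult_left_mono divide_right_mono) (auto simp: prod)
      also have "exp (real n * b) / (\<Prod>j<n. a j) * (exp ((ln K + (b - \<theta> * p * r ^ n)) / p) / a n)
          = exp (real n * b - c n + ((ln K + (b - \<theta> * p * r ^ n)) / p - (b - \<theta> * p * r ^ n)))"
        unfolding prod by (simp only: a_def exp_add exp_diff)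
      also have "real n * b - c n + ((ln K + (b - \<theta> * p * r ^ n)) / p - (b - \<theta> * p * r ^ n))
          = ln K / p + b * q / p - \<theta> * q"
        using p by (simp add: c_def q_def field_simps)
      finally show "(2 powr (1 / p)) ^ n / (\<Prod>j<n. a j) * (len n powr (1 / p) / a n) \<le> C"
        by (simp add: C_def)
    qed
    finally show ?thesis .
  qed
  moreover have "norm (nderiv n f x) \<le> exp (u n)" for n x
  proof -
    have "norm (nderiv n f x) \<le> 2 ^ n * (1 / a n) / (\<Prod>j<n. a j)"
      unfolding f_def[abs_def] by (rule norm_nderiv_cascade_le)
    also have "\<dots> = exp (real n * ln 2 - (b - \<theta> * p * r ^ n) - c n)"
      unfolding prod by (simp add: a_def exp_diff exp_of_nat_mult)
    also have "real n * ln 2 - (b - \<theta> * p * r ^ n) - c n = u n"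
      by (simp add: u_def c_def p_eq algebra_simps)
    finally show ?thesis .
  qed
  moreover have "(\<lambda>n. (1 - p) ^ n * u n) \<longlonglongrightarrow> \<theta>"
    using lim[of "ln 2 - b" "- b - \<theta> * q"] by (simp add: u_def add.assoc diff_diff_eq algebra_simps)
  moreover have "\<forall>\<^sub>F n in sequentially. \<exists>x. exp (l n) \<le> norm (nderiv n f x)"
  proof -
    \<comment> \<open>The ratio \<open>\<rho>\<close> does not suffice here, since
      \<open>K * \<rho>\<close> may exceed 1. Consecutive ratios \<open>a (Suc m) / a m\<close> are
      at most \<open>\<sigma> ^ m\<close>, hence tend to 0 and eventually beat
      \<open>K\<close>.\<close>
    define \<sigma> where "\<sigma> = exp (- (\<theta> * p * (r - 1) * (r - 1)))"
    have \<sigma>: "0 < \<sigma>" "\<sigma> < 1" using \<theta> p r by (auto simp: \<sigma>_def)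
    have "(\<lambda>m. K * \<sigma> ^ m) \<longlonglongrightarrow> K * 0"
      using \<sigma> by (intro tendsto_intros LIMSEQ_power_zero) auto
    then have "\<forall>\<^sub>F m in sequentially. K * \<sigma> ^ m < 1"
      by (intro order_tendstoD) auto
    then have "\<forall>\<^sub>F m in sequentially. \<exists>x. exp (l (Suc m)) \<le> norm (nderiv (Suc m) f x)"
    proof eventually_elim
      case (elim m)
      have "len (Suc m) \<le> a j" if "j < Suc m" for j
      proof -
        have "a (Suc m) \<le> \<sigma> ^ m * a m"
        proof -
          have "real m * (r - 1) \<le> r ^ m" using bern[of m] by simp
          then have "\<theta> * p * (r - 1) * (real m * (r - 1)) \<le> \<theta> * p * (r - 1) * r ^ m"
            using \<theta> p r by (intro mult_left_mono) auto
          then have "b - \<theta> * p * r ^ Suc m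
              \<le> real m * - (\<theta> * p * (r - 1) * (r - 1)) + (b - \<theta> * p * r ^ m)"
            by (simp add: algebra_simps)
          then show ?thesis
            by (simp only: a_def \<sigma>_def exp_of_nat_mult[symmetric] exp_add[symmetric] exp_le_cancel_iff)
        qed
        then have "K * a (Suc m) \<le> K * \<sigma> ^ m * a m" using K by simp
        also have "\<dots> \<le> 1 * a m" using elim apos[of m] by (intro mult_right_mono) auto
        also have "a m \<le> \<rho> ^ (m - j) * a j" using decay[of j "m - j"] that by simp
        also have "\<dots> \<le> 1 * a j" using \<rho> apos[of j] by (intro mult_right_mono power_le_one) auto
        finally show ?thesis using len_le[of "Suc m"] by simp
      qed
      then obtain x where x: "norm (nderiv (Suc m) f x) = 1 / len (Suc m) / (\<Prod>j<Suc m. a j)"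
        unfolding f_def[abs_def] using norm_nderiv_cascade_ge by blast
      have "exp (l (Suc m)) = exp (- ln K - (b - \<theta> * p * r ^ Suc m) - c (Suc m))"
        by (simp add: l_def c_def p_eq algebra_simps)
      also have "\<dots> = 1 / (K * a (Suc m)) / (\<Prod>j<Suc m. a j)"
        using K unfolding prod by (simp add: a_def exp_diff exp_minus exp_add field_simps)
      also have "\<dots> \<le> 1 / len (Suc m) / (\<Prod>j<Suc m. a j)"
        using len_le len_pos K apos by (intro divide_right_mono divide_left_mono) (auto simp: prod_nonneg less_imp_le)
      finally show ?case using x by (intro exI[of _ x]) simp
    qed
    then show ?thesis
      using eventually_sequentially_Suc[of "\<lambda>n. \<exists>x. exp (l n) \<le> norm (nderiv n f x)"] by blast
  qed
  moreover have "(\<lambda>n. (1 - p) ^ n * l n) \<longlonglongrightarrow> \<theta>"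
    using lim[of "- b" "- ln K - b - \<theta> * q"] by (simp add: l_def algebra_simps)
  ultimately show ?thesis by (rule that)
qed

section \<open>Separation of the two completions\<close>

theorem theorem0p6p5:
  fixes p \<theta> \<theta>' :: real and M :: "nat \<Rightarrow> real"
  assumes "0 < p" and "p < 1"
    and "weight_sequence M" and "incseq M" and "log_convex_seq M"
    and "p_characteristic p M < \<infinity>"
    and "0 \<le> \<theta>" and "\<theta> < \<theta>'"
  shows "carleman_incl p \<theta>' M ` carleman_space p \<theta> M \<subset> carleman_space p \<theta>' M"
proof -
  have p: "0 < p" "p < 1" "p \<le> 1" and le: "\<theta> \<le> \<theta>'" and pos: "0 < \<theta>'" using assms by auto
  have M: "0 < M n" "M 0 \<le> M n" for n
    using assms by (auto simp: weight_sequence_def incseq_def)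
  obtain S where S: "(\<lambda>n. \<Sum>j=1..n. (1 - p) ^ j * ln (M j)) \<longlonglongrightarrow> S"
    using p_characteristic_convergent[of p M] assms by blast
  obtain f C u l where f: "smooth f" "0 < C" "\<And>n. Lp_qnorm p (nderiv n f) \<le> ennreal C"
    "\<And>n x. norm (nderiv n f x) \<le> exp (u n)" "(\<lambda>n. (1 - p) ^ n * u n) \<longlonglongrightarrow> \<theta>'"
    "\<forall>\<^sub>F n in sequentially. \<exists>x. exp (l n) \<le> norm (nderiv n f x)" "(\<lambda>n. (1 - p) ^ n * l n) \<longlonglongrightarrow> \<theta>'"
    using extremal_function[OF p(1,2) pos] by blast
  \<comment> \<open>The uniform bound \<open>C\<close> suffices because the weights increase, so
    \<open>M 0\<close> is the smallest.\<close>
  have "carleman_qnorm p M f \<le> ennreal (C / M 0)"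
    unfolding carleman_qnorm_def
  proof (rule SUP_least)
    fix n
    have "Lp_qnorm p (nderiv n f) / ennreal (M n) \<le> ennreal C / ennreal (M n)"
      by (intro divide_right_mono_ennreal f)
    also have "\<dots> = ennreal (C / M n)" using f M by (simp add: divide_ennreal)
    also have "\<dots> \<le> ennreal (C / M 0)" using f(2) M[of n] M[of 0] by (intro ennreal_leI divide_left_mono) auto
    finally show "Lp_qnorm p (nderiv n f) / ennreal (M n) \<le> ennreal (C / M 0)" .
  qed
  then have f_in: "f \<in> test_class p \<theta>' M"
    using limsup_growth_le[OF _ f(4,5)] p f(1) by (auto simp: test_class_def intro: le_less_trans)
  have f_notin: "f \<notin> test_class p \<theta> M"
  proof
    assume "f \<in> test_class p \<theta> M"
    then have "limsup (\<lambda>n. ereal ((1 - p) ^ n) * eln (sup_norm (nderiv n f))) \<le> ereal \<theta>"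
      by (simp add: test_class_def)
    moreover have "limsup (\<lambda>n. ereal ((1 - p) ^ n * l n))
        \<le> limsup (\<lambda>n. ereal ((1 - p) ^ n) * eln (sup_norm (nderiv n f)))"
    proof (rule Limsup_mono, use f(6) in eventually_elim)
      case (elim n)
      then obtain x where "exp (l n) \<le> norm (nderiv n f x)" by blast
      then have "ennreal (exp (l n)) \<le> sup_norm (nderiv n f)"
        unfolding sup_norm_def by (intro SUP_upper2[of x] ennreal_leI) auto
      then have "ereal ((1 - p) ^ n) * ereal (l n) \<le> ereal ((1 - p) ^ n) * eln (sup_norm (nderiv n f))"
        using p by (intro ereal_mult_left_mono eln_ge) auto
      then show ?case by simp
    qed
    moreover have "limsup (\<lambda>n. ereal ((1 - p) ^ n * l n)) = ereal \<theta>'"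
      using f(7) by (intro lim_imp_Limsup) auto
    ultimately have "ereal \<theta>' \<le> ereal \<theta>" by order
    then show False using assms by simp
  qed
  have c: "(\<lambda>_. f) \<in> test_Cauchy p \<theta>' M"
    using f_in by (auto simp: test_Cauchy_def carleman_qnorm_zero)
  \<comment> \<open>The separating element is the class of the constant sequence \<open>f\<close>. A
    preimage would be represented by a sequence of the smaller test class converging to
    \<open>f\<close>, which closedness excludes.\<close>
  define X where "X = null_rel p \<theta>' M `` {\<lambda>_. f}"
  have "X \<in> carleman_space p \<theta>' M"
    using c by (auto simp: X_def carleman_space_def intro: quotientI)
  moreover have "X \<notin> carleman_incl p \<theta>' M ` carleman_space p \<theta> M"
  proof
    assume "X \<in> carleman_incl p \<theta>' M ` carleman_space p \<theta> M"
    then obtain v where v: "v \<in> test_Cauchy p \<theta> M" "X = carleman_incl p \<theta>' M (null_rel p \<theta> M `` {v})"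
      by (auto simp: carleman_space_def elim!: quotientE)
    then have "X = null_rel p \<theta>' M `` {v}"
      using carleman_incl_class[OF p(1,3) le v(1)] by simp
    then have "(v, \<lambda>_. f) \<in> null_rel p \<theta>' M"
      using equiv_class_self[OF equiv_null_rel[OF p(1,3)] c] by (auto simp: X_def)
    then have "(\<lambda>n. carleman_qnorm p M (\<lambda>x. v n x - f x)) \<longlonglongrightarrow> 0"
      by (simp add: null_rel_def)
    moreover have "v n \<in> test_class p \<theta> M" for n
      using v(1) by (auto simp: test_Cauchy_def)
    ultimately show False
      using test_class_closed[OF p(1,2) assms(3) S _ f_in] f_notin by blast
  qed
  ultimately show ?thesis
    using carleman_incl_space[OF p(1,3) le, of M] by blast
qed

end
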